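(* Let $T'$ be a rooted tree with a distinguished non-root leaf $\ell$ whose direct ancestor is $h$, let $S_m$ be the rooted star tree with root leaf labeled $h$ and unique internal vertex labeled $\ell$, and let $T$ be the rooted tree obtained from $T'$ and $S_m$ by identifying the vertices labeled $h$, the vertices labeled $\ell$, and the edge between them. Then $$I(B_T)=I(B_{T'}^{\star})\times_{\mathcal{A}}I(B_{S_m}^{\star}),$$ where $\times_{\mathcal{A}}$ denotes the toric fiber product defined in the context.
   Context: Trees. All trees are rooted at a leaf (degree-one vertex), all edges are directed away from the root, and no vertex has degree two. $\mathrm{Lv}(T)$ is the set of leaves, including the root. $S_m$ is the star tree: it has $m+1$ leaves (one of which is the root) and a unique internal vertex. The glued tree $T$ is rooted at the root of $T'$, and its leaf set is $\mathrm{Lv}(T)=(\mathrm{Lv}(T')\setminus\{\ell\})\sqcup(\mathrm{Lv}(S_m)\setminus\{h\})$. Toric ideals. For an integer matrix $A$ with columns $\mathbf{a}_1,\dots,\mathbf{a}_k$ and $d$ rows, $I(A)$ is the kernel of $\mathbb{C}[p_1,\dots,p_k]\to\mathbb{C}[t_1^\pm,\dots,t_d^\pm]$, $p_i\mapsto\mathbf{t}^{\mathbf{a}_i}$. The matrices $B_T$ and $B_T^\star$. For a rooted tree $T$ with edge set $E(T)$, $B_T$ is the matrix with rows indexed by $E(T)$ and columns indexed by unordered pairs $\{i,j\}$ of distinct leaves, with $B_T(e,\{i,j\})=1$ if $e$ lies on the unique shortest path in $T$ between $i$ and $j$, and $0$ otherwise. $B_T^\star$ has one extra row $\star$ and one extra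 column $\star$: $B_T^\star(e,\{i,j\})=B_T(e,\{i,j\})$, $B_T^\star(e,\star)=0$ for all $e\in E(T)$, and $B_T^\star(\star,\{i,j\})=B_T^\star(\star,\star)=1$. Rings. $I(B_T)\subset\mathbb{C}[\mathbf{p}]=\mathbb{C}[p_{i,j}\mid i,j\in \mathrm{Lv}(T),\, i\ne j]$, $I(B_{T'}^\star)\subset\mathbb{C}[q_\star,\mathbf{q}]$ with $\mathbf{q}=(q_{i,j})_{i\neq j\in\mathrm{Lv}(T')}$, and $I(B_{S_m}^\star)\subset\mathbb{C}[r_\star,\mathbf{r}]$ with $\mathbf{r}=(r_{i,j})_{i\ne j\in\mathrm{Lv}(S_m)}$. Subscripts are unordered pairs, and the variables with subscript $\star$ correspond to the columns $\star$. Multigrading. $\deg(q_\star)=[0,0,1]$; $\deg(q_{i,j})=[1,0,0]$ if $i,j\ne\ell$, and $[0,1,0]$ if $i=\ell$ or $j=\ell$; $\deg(r_\star)=[1,0,0]$; $\deg(r_{i,j})=[0,0,1]$ if $i,j\neq h$, and $[0,1,0]$ if $i=h$ or $j=h$. $\mathcal{A}$ is the $3\times3$ identity matrix, whose rows are these multidegrees. Both ideals $I(B_{T'}^\star)$ and $I(B_{S_m}^\star)$ are multi-homogeneous. Toric fiber product. Put $R_{T'}=\mathbb{C}[q_\star,\mathbf{q}]/I(B_{T'}^\star)$ and $R_{S_m}=\mathbb{C}[r_\star,\mathbf{r}]/I(B_{S_m}^\star)$. Then $I(B_{T'}^{\star})\times_{\mathcal{A}}I(B_{S_m}^{\star})$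 is the kernel of the $\mathbb{C}$-algebra homomorphism $\psi_{T',S_m}:\mathbb{C}[\mathbf{p}]\to R_{T'}\otimes_{\mathbb{C}}R_{S_m}$ given by - $p_{i,j}\mapsto q_{i,j}\otimes r_\star$ if $i,j\in\mathrm{Lv}(T')\setminus\{\ell\}$; - $p_{i,j}\mapsto q_\star\otimes r_{i,j}$ if $i,j\in\mathrm{Lv}(S_m)\setminus\{h\}$; - $p_{i,j}\mapsto q_{i,\ell}\otimes r_{h,j}$ if $i\in\mathrm{Lv}(T')\setminus\{\ell\}$ and $j\in\mathrm{Lv}(S_m)\setminus\{h\}$. *)

theory Defs
  imports
    Complex_Main
    "HOL-Library.Poly_Mapping"
    "HOL-Algebra.Algebra"
    "Graph_Theory.Graph_Theory"
begin

section \<open>Rooted trees\<close>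

text \<open>
  A rooted tree is stored as the digraph whose arcs are its edges directed away from the root.
  An arc \<open>(u, v)\<close> therefore says that \<open>u\<close> is the direct ancestor of \<open>v\<close>.
\<close>

record 'a rtree =
  tree_graph :: "'a pair_pre_digraph"
  tree_root :: 'a

definition vert_degree :: "'a rtree \<Rightarrow> 'a \<Rightarrow> nat" where
  "vert_degree T v = in_degree (tree_graph T) v + out_degree (tree_graph T) v"

definition Lv :: "'a rtree \<Rightarrow> 'a set" where
  "Lv T = {v \<in> pverts (tree_graph T). vert_degree T v = 1}"

text \<open>
  That every vertex is the end of exactly one directed walk from the root says that the underlying
  graph is a tree and that all arcs point away from the root.  The tree with one edge is allowed.
\<close>

definition rooted_tree :: "'a rtree \<Rightarrow> bool" where
  "rooted_tree T \<longleftrightarrow>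
     pair_fin_digraph (tree_graph T) \<and>
     tree_root T \<in> Lv T \<and>
     (\<forall>v \<in> pverts (tree_graph T). \<exists>!p. pre_digraph.awalk (tree_graph T) (tree_root T) p v) \<and>
     (\<forall>v \<in> pverts (tree_graph T). vert_degree T v \<noteq> 2)"

definition star_tree :: "nat \<Rightarrow> 'a \<Rightarrow> 'a \<Rightarrow> 'a rtree \<Rightarrow> bool" where
  "star_tree m h l S \<longleftrightarrow>
     rooted_tree S \<and> tree_root S = h \<and> card (Lv S) = m + 1 \<and> pverts (tree_graph S) - Lv S = {l}"

text \<open>
  Vertices of the two trees are identified when they carry the same label, that is, when they are
  the same element of the type of vertices.
\<close>

definition glue :: "'a rtree \<Rightarrow> 'a rtree \<Rightarrow> 'a rtree" where
  "glue T' S =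
     \<lparr> tree_graph = \<lparr> pverts = pverts (tree_graph T') \<union> pverts (tree_graph S),
                 parcs = parcs (tree_graph T') \<union> parcs (tree_graph S) \<rparr>,
       tree_root = tree_root T' \<rparr>"


section \<open>The matrices of a tree\<close>

definition upairs :: "'a set \<Rightarrow> 'a set set" where
  "upairs L = {{i, j} | i j. i \<in> L \<and> j \<in> L \<and> i \<noteq> j}"

text \<open>Paths ignore the direction of the edges, hence the symmetric closure.\<close>

definition shortest_path :: "'a rtree \<Rightarrow> 'a \<Rightarrow> ('a \<times> 'a) list \<Rightarrow> 'a \<Rightarrow> bool" where
  "shortest_path T i p j \<longleftrightarrow>
     pre_digraph.awalk (mk_symmetric (tree_graph T)) i p j \<and>
     (\<forall>q. pre_digraph.awalk (mk_symmetric (tree_graph T)) i q j \<longrightarrow> length p \<le> length q)"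

definition B_mat :: "'a rtree \<Rightarrow> 'a \<times> 'a \<Rightarrow> 'a set \<Rightarrow> int" where
  "B_mat T e c =
     (if \<exists>i j p. c = {i, j} \<and> i \<noteq> j \<and> shortest_path T i p j \<and> (e \<in> set p \<or> prod.swap e \<in> set p)
      then 1 else 0)"

text \<open>In row and column indices, \<^term>\<open>None\<close> is the additional index \<open>\<star>\<close>.\<close>

fun B_mat_star :: "'a rtree \<Rightarrow> ('a \<times> 'a) option \<Rightarrow> 'a set option \<Rightarrow> int" where
  "B_mat_star T (Some e) (Some c) = B_mat T e c"
| "B_mat_star T (Some e) None = 0"
| "B_mat_star T None c = 1"


section \<open>Polynomial rings and toric ideals\<close>

text \<open>
  A commutative \<open>\<complex>\<close>-algebra is a \<open>module\<close> record whose scalars have type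
  \<^typ>\<open>complex\<close>.  The monoid algebra below is \<open>\<complex>[M]\<close> for a submonoid \<open>M\<close> of a type of
  exponents.
\<close>

definition monoid_alg :: "'m::comm_monoid_add set \<Rightarrow> (complex, 'm \<Rightarrow>\<^sub>0 complex) module" where
  "monoid_alg M =
     \<lparr> carrier = {f. Poly_Mapping.keys f \<subseteq> M}, monoid.mult = (*), monoid.one = 1, ring.zero = 0, ring.add = (+),
       module.smult = (\<lambda>c. Poly_Mapping.map ((*) c)) \<rparr>"

definition poly_alg :: "'v set \<Rightarrow> (complex, ('v \<Rightarrow>\<^sub>0 nat) \<Rightarrow>\<^sub>0 complex) module" where
  "poly_alg V = monoid_alg {m. Poly_Mapping.keys m \<subseteq> V}"

definition laurent_alg :: "'r set \<Rightarrow> (complex, ('r \<Rightarrow>\<^sub>0 int) \<Rightarrow>\<^sub>0 complex) module" where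
  "laurent_alg R = monoid_alg {m. Poly_Mapping.keys m \<subseteq> R}"

definition poly_var :: "'v \<Rightarrow> ('v \<Rightarrow>\<^sub>0 nat) \<Rightarrow>\<^sub>0 complex" where
  "poly_var v = Poly_Mapping.single (Poly_Mapping.single v 1) 1"

text \<open>The \<open>\<complex>\<close>-algebra homomorphism into \<open>S\<close> that sends each variable \<open>v\<close> to \<open>x v\<close>.\<close>

definition subst_hom ::
  "(complex, 'b) module \<Rightarrow> ('v \<Rightarrow> 'b) \<Rightarrow> (('v \<Rightarrow>\<^sub>0 nat) \<Rightarrow>\<^sub>0 complex) \<Rightarrow> 'b" where
  "subst_hom S x f =
     (\<Oplus>\<^bsub>S\<^esub>m \<in> Poly_Mapping.keys f. Poly_Mapping.lookup f m \<odot>\<^bsub>S\<^esub>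
        (\<Otimes>\<^bsub>S\<^esub>v \<in> Poly_Mapping.keys m. x v [^]\<^bsub>S\<^esub> Poly_Mapping.lookup m v))"

text \<open>
  A matrix is given by its finite set \<open>R\<close> of rows, its set \<open>K\<close> of columns and its entries \<open>A\<close>.
\<close>

definition column_monomial ::
  "'r set \<Rightarrow> ('r \<Rightarrow> 'k \<Rightarrow> int) \<Rightarrow> 'k \<Rightarrow> ('r \<Rightarrow>\<^sub>0 int) \<Rightarrow>\<^sub>0 complex" where
  "column_monomial R A k = Poly_Mapping.single (\<Sum>r\<in>R. Poly_Mapping.single r (A r k)) 1"

definition toric_ideal ::
  "'r set \<Rightarrow> 'k set \<Rightarrow> ('r \<Rightarrow> 'k \<Rightarrow> int) \<Rightarrow> (('k \<Rightarrow>\<^sub>0 nat) \<Rightarrow>\<^sub>0 complex) set" where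
  "toric_ideal R K A =
     a_kernel (poly_alg K) (laurent_alg R) (subst_hom (laurent_alg R) (column_monomial R A))"

definition tree_ideal :: "'a rtree \<Rightarrow> (('a set \<Rightarrow>\<^sub>0 nat) \<Rightarrow>\<^sub>0 complex) set" where
  "tree_ideal T = toric_ideal (parcs (tree_graph T)) (upairs (Lv T)) (B_mat T)"

definition star_rows :: "'a rtree \<Rightarrow> ('a \<times> 'a) option set" where
  "star_rows T = insert None (Some ` parcs (tree_graph T))"

definition star_cols :: "'a rtree \<Rightarrow> 'a set option set" where
  "star_cols T = insert None (Some ` upairs (Lv T))"

definition tree_ideal_star :: "'a rtree \<Rightarrow> (('a set option \<Rightarrow>\<^sub>0 nat) \<Rightarrow>\<^sub>0 complex) set" where
  "tree_ideal_star T = toric_ideal (star_rows T) (star_cols T) (B_mat_star T)"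


section \<open>Quotients and tensor products of algebras\<close>

text \<open>The quotient ring of the library, together with the induced scalar multiplication.\<close>

definition quot_alg :: "(complex, 'b) module \<Rightarrow> 'b set \<Rightarrow> (complex, 'b set) module" where
  "quot_alg A I =
     \<lparr> carrier = carrier (A Quot I), monoid.mult = monoid.mult (A Quot I), monoid.one = \<one>\<^bsub>A Quot I\<^esub>,
       ring.zero = \<zero>\<^bsub>A Quot I\<^esub>, ring.add = ring.add (A Quot I),
       module.smult = (\<lambda>c C. \<Union>x\<in>C. I +>\<^bsub>A\<^esub> (c \<odot>\<^bsub>A\<^esub> x)) \<rparr>"

text \<open>
  The tensor product \<open>A \<otimes> B\<close> over \<open>\<complex>\<close> is the vector space with basis \<open>carrier A \<times> carrier B\<close>
  modulo the span of the bilinearity relations.  The multiplication is induced by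
  \<open>(a, b) (a', b') = (a a', b b')\<close> on basis vectors, for which that span is an ideal.
\<close>

definition free_alg ::
  "(complex, 'b) module \<Rightarrow> (complex, 'c) module \<Rightarrow> (complex, ('b \<times> 'c) \<Rightarrow>\<^sub>0 complex) module" where
  "free_alg A B =
     \<lparr> carrier = {f. Poly_Mapping.keys f \<subseteq> carrier A \<times> carrier B},
       monoid.mult = (\<lambda>f g. \<Sum>(a, b) \<in> Poly_Mapping.keys f. \<Sum>(a', b') \<in> Poly_Mapping.keys g.
         Poly_Mapping.single (a \<otimes>\<^bsub>A\<^esub> a', b \<otimes>\<^bsub>B\<^esub> b')
           (Poly_Mapping.lookup f (a, b) * Poly_Mapping.lookup g (a', b'))),
       monoid.one = Poly_Mapping.single (\<one>\<^bsub>A\<^esub>, \<one>\<^bsub>B\<^esub>) 1,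
       ring.zero = 0, ring.add = (+), module.smult = (\<lambda>c. Poly_Mapping.map ((*) c)) \<rparr>"

definition bilinear_gens ::
  "(complex, 'b) module \<Rightarrow> (complex, 'c) module \<Rightarrow> (('b \<times> 'c) \<Rightarrow>\<^sub>0 complex) set" where
  "bilinear_gens A B =
     (let \<delta> = (\<lambda>a b. Poly_Mapping.single (a, b) (1 :: complex));
          scale = (\<lambda>c. Poly_Mapping.map ((*) c)) in
      {\<delta> (a \<oplus>\<^bsub>A\<^esub> a') b - \<delta> a b - \<delta> a' b | a a' b. a \<in> carrier A \<and> a' \<in> carrier A \<and> b \<in> carrier B} \<union>
      {\<delta> a (b \<oplus>\<^bsub>B\<^esub> b') - \<delta> a b - \<delta> a b' | a b b'. a \<in> carrier A \<and> b \<in> carrier B \<and> b' \<in> carrier B} \<union>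
      {\<delta> (c \<odot>\<^bsub>A\<^esub> a) b - scale c (\<delta> a b) | c a b. a \<in> carrier A \<and> b \<in> carrier B} \<union>
      {\<delta> a (c \<odot>\<^bsub>B\<^esub> b) - scale c (\<delta> a b) | c a b. a \<in> carrier A \<and> b \<in> carrier B})"

definition bilinear_rels ::
  "(complex, 'b) module \<Rightarrow> (complex, 'c) module \<Rightarrow> (('b \<times> 'c) \<Rightarrow>\<^sub>0 complex) set" where
  "bilinear_rels A B = Modules.module.span (\<lambda>c. Poly_Mapping.map ((*) c)) (bilinear_gens A B)"

definition tensor_alg ::
  "(complex, 'b) module \<Rightarrow> (complex, 'c) module \<Rightarrow>
   (complex, (('b \<times> 'c) \<Rightarrow>\<^sub>0 complex) set) module" where
  "tensor_alg A B = quot_alg (free_alg A B) (bilinear_rels A B)"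

definition pure_tensor ::
  "(complex, 'b) module \<Rightarrow> (complex, 'c) module \<Rightarrow> 'b \<Rightarrow> 'c \<Rightarrow> (('b \<times> 'c) \<Rightarrow>\<^sub>0 complex) set" where
  "pure_tensor A B a b = bilinear_rels A B +>\<^bsub>free_alg A B\<^esub> Poly_Mapping.single (a, b) 1"


section \<open>The toric fiber product\<close>

text \<open>
  \<open>I\<close> and \<open>J\<close> are ideals of \<open>\<complex>[q\<^sub>\<star>, q]\<close> and \<open>\<complex>[r\<^sub>\<star>, r]\<close>, the polynomial rings on the columns of
  the starred matrices of \<open>T'\<close> and \<open>S\<close>.  A pair \<open>c\<close> of leaves of the glued tree that lies in
  neither part has the form \<open>{i, j}\<close> with \<open>i\<close> in the first and \<open>j\<close> in the second.
\<close>

definition tfp_var ::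
  "'a rtree \<Rightarrow> 'a rtree \<Rightarrow> 'a \<Rightarrow> 'a \<Rightarrow>
   (('a set option \<Rightarrow>\<^sub>0 nat) \<Rightarrow>\<^sub>0 complex) set \<Rightarrow> (('a set option \<Rightarrow>\<^sub>0 nat) \<Rightarrow>\<^sub>0 complex) set \<Rightarrow>
   'a set \<Rightarrow>
   ((('a set option \<Rightarrow>\<^sub>0 nat) \<Rightarrow>\<^sub>0 complex) set \<times> (('a set option \<Rightarrow>\<^sub>0 nat) \<Rightarrow>\<^sub>0 complex) set
     \<Rightarrow>\<^sub>0 complex) set" where
  "tfp_var T' S h l I J c =
     (let Q = poly_alg (star_cols T'); R = poly_alg (star_cols S);
          q = (\<lambda>k. I +>\<^bsub>Q\<^esub> poly_var k); r = (\<lambda>k. J +>\<^bsub>R\<^esub> poly_var k);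
          tensor = pure_tensor (quot_alg Q I) (quot_alg R J);
          L1 = Lv T' - {l}; L2 = Lv S - {h} in
      if c \<subseteq> L1 then tensor (q (Some c)) (r None)
      else if c \<subseteq> L2 then tensor (q None) (r (Some c))
      else (let i = (THE i. i \<in> c \<inter> L1); j = (THE j. j \<in> c \<inter> L2) in
            tensor (q (Some {i, l})) (r (Some {h, j}))))"

definition toric_fiber_product ::
  "'a rtree \<Rightarrow> 'a rtree \<Rightarrow> 'a \<Rightarrow> 'a \<Rightarrow>
   (('a set option \<Rightarrow>\<^sub>0 nat) \<Rightarrow>\<^sub>0 complex) set \<Rightarrow> (('a set option \<Rightarrow>\<^sub>0 nat) \<Rightarrow>\<^sub>0 complex) set \<Rightarrow>
   (('a set \<Rightarrow>\<^sub>0 nat) \<Rightarrow>\<^sub>0 complex) set" where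
  "toric_fiber_product T' S h l I J =
     (let RR = tensor_alg (quot_alg (poly_alg (star_cols T')) I) (quot_alg (poly_alg (star_cols S)) J)
      in a_kernel (poly_alg (upairs (Lv (glue T' S)))) RR
           (subst_hom RR (tfp_var T' S h l I J)))"

end

theory Submission
  imports Defs "HOL-Library.Product_Plus"
begin

text \<open>
  All maps in sight send variables to monomials, and the kernel of such a map is determined by how it
  partitions the monomials: a polynomial lies in the kernel iff its coefficients sum to zero over
  each set of monomials with the same image.  For toric ideals this is \<open>toric_ideal_eq\<close>.  For the
  toric fiber product it is \<open>kernel_of_monomial_tensors\<close>, since the residue class of a monomial
  modulo a toric ideal is determined by its degree, and distinct pairs of degrees give linearly
  independent pure tensors.  What has to be shown is therefore that two monomials in the variables
  \<open>p\<close> have the same degree with respect to the matrix of \<open>T\<close> iff both of their factors, in the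
  variables \<open>q\<close> and in the variables \<open>r\<close>, have the same degree with respect to the starred matrices of
  \<open>T'\<close> and \<open>S\<close> (\<open>same_degree_iff\<close>).

  An edge \<open>e\<close> of a tree separates the vertices into two sides, and it lies on the path between two
  vertices iff they are on different sides (\<open>B_mat_cut\<close>).  The glued tree retracts onto \<open>T'\<close> by moving
  the leaves of the star except \<open>h\<close> to \<open>l\<close>.  For an edge of \<open>T'\<close>, the sides in \<open>T\<close> are the preimages of the sides
  in \<open>T'\<close>, so the row of \<open>e\<close> in the matrix of \<open>T\<close> is obtained from its row in the matrix of \<open>T'\<close> by
  applying the retraction to pairs of leaves.  A pair that is moved to a single vertex has entry \<open>0\<close>,
  which is the entry of the column \<open>\<star>\<close>.  The same holds for \<open>S\<close> and the retraction that moves the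
  vertices of \<open>T'\<close> other than \<open>l\<close> to \<open>h\<close>.

  Only the rows \<open>\<star>\<close> of the starred matrices have no counterpart in the matrix of \<open>T\<close>.  They record the
  total degree of a monomial.  The matrix of \<open>T\<close> determines it as well: when the row of the edge at a
  leaf is added up over all leaves, every column gets the entry \<open>2\<close>, because a path between two
  leaves uses the edge at \<open>v\<close> iff it ends at \<open>v\<close>.
\<close>

section \<open>Pushing forward coefficients\<close>

text \<open>
  The bound on the supports is what allows laws that hold only on the carrier of a ring to be used
  in the step for a single term.
\<close>

lemma poly_mapping_induct_keys [consumes 1, case_names zero single add]:
  fixes f :: "'k \<Rightarrow>\<^sub>0 'c::comm_monoid_add"
  assumes "Poly_Mapping.keys f \<subseteq> K"
    and zero: "P 0"
    and single: "\<And>k c. k \<in> K \<Longrightarrow> P (Poly_Mapping.single k c)"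
    and add: "\<And>f g. Poly_Mapping.keys f \<subseteq> K \<Longrightarrow> Poly_Mapping.keys g \<subseteq> K \<Longrightarrow> P f \<Longrightarrow> P g \<Longrightarrow> P (f + g)"
  shows "P f"
proof -
  have decomp: "f = (\<Sum>k\<in>Poly_Mapping.keys f. Poly_Mapping.single k (Poly_Mapping.lookup f k))"
    by (rule poly_mapping_eqI)
      (simp add: lookup_sum lookup_single when_def sum.delta' in_keys_iff)
  have "Poly_Mapping.keys (\<Sum>k\<in>B. Poly_Mapping.single k (Poly_Mapping.lookup f k)) \<subseteq> K \<and>
      P (\<Sum>k\<in>B. Poly_Mapping.single k (Poly_Mapping.lookup f k))"
    if "finite B" "B \<subseteq> K" for B
    using that
  proof (induction B rule: finite_induct)
    case (insert b B)
    let ?s = "Poly_Mapping.single b (Poly_Mapping.lookup f b)"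
    have "Poly_Mapping.keys ?s \<subseteq> K" using insert.prems by simp
    moreover have "P ?s" using single insert.prems by simp
    ultimately show ?case
      using insert add keys_add[of ?s "\<Sum>k\<in>B. Poly_Mapping.single k (Poly_Mapping.lookup f k)"]
      by (simp add: subset_eq) blast
  qed (simp add: zero)
  from this[OF finite_keys assms(1)] show ?thesis using decomp by simp
qed

text \<open>
  The linear map \<open>\<complex>[M] \<rightarrow> \<complex>[N]\<close> that a map \<open>g\<close> of exponents induces: it adds up the coefficients
  over each fibre of \<open>g\<close>.
\<close>

definition pushforward :: "('k \<Rightarrow> 'n) \<Rightarrow> ('k \<Rightarrow>\<^sub>0 'c::comm_monoid_add) \<Rightarrow> ('n \<Rightarrow>\<^sub>0 'c)" where
  "pushforward g f =
     (\<Sum>k\<in>Poly_Mapping.keys f. Poly_Mapping.single (g k) (Poly_Mapping.lookup f k))"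

lemma pushforward_zero [simp]: "pushforward g 0 = 0"
  by (simp add: pushforward_def)

lemma pushforward_add: "pushforward g (f + f') = pushforward g f + pushforward g f'"
  unfolding pushforward_def by (rule setsum_keys_plus_distrib) (simp_all add: single_add)

lemma pushforward_single [simp]: "pushforward g (Poly_Mapping.single k c) = Poly_Mapping.single (g k) c"
  by (simp add: pushforward_def)

lemma pushforward_diff:
  fixes f f' :: "'k \<Rightarrow>\<^sub>0 'c::ab_group_add"
  shows "pushforward g (f - f') = pushforward g f - pushforward g f'"
  using pushforward_add[of g "f - f'" f'] by simp

lemma pushforward_cong:
  "(\<And>k. k \<in> Poly_Mapping.keys f \<Longrightarrow> g k = g' k) \<Longrightarrow> pushforward g f = pushforward g' f"
  by (simp add: pushforward_def)

lemma pushforward_comp: "pushforward h (pushforward g f) = pushforward (\<lambda>k. h (g k)) f"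
proof -
  have "Poly_Mapping.keys f \<subseteq> UNIV" by simp
  then show ?thesis by (induction f rule: poly_mapping_induct_keys) (simp_all add: pushforward_add)
qed

lemma pushforward_mult:
  fixes f f' :: "'k::comm_monoid_add \<Rightarrow>\<^sub>0 'c::comm_semiring_1" and g :: "'k \<Rightarrow> 'n::comm_monoid_add"
  assumes "\<And>k k'. g (k + k') = g k + g k'"
  shows "pushforward g (f * f') = pushforward g f * pushforward g f'"
proof -
  have single: "pushforward g (Poly_Mapping.single k c * f') = Poly_Mapping.single (g k) c * pushforward g f'" for k c
  proof -
    have "Poly_Mapping.keys f' \<subseteq> UNIV" by simp
    then show ?thesis
      by (induction f' rule: poly_mapping_induct_keys)
        (simp_all add: pushforward_add mult_single assms distrib_left)
  qed
  have "Poly_Mapping.keys f \<subseteq> UNIV" by simp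
  then show ?thesis
    by (induction f rule: poly_mapping_induct_keys)
      (simp_all add: pushforward_add single distrib_right)
qed

text \<open>
  A polynomial is killed by \<open>pushforward d\<close> iff its coefficients sum to zero over each fibre of \<open>d\<close>,
  and here each fibre of \<open>g\<close> is a union of fibres of \<open>d\<close>.
\<close>

lemma pushforward_eq_0_transfer:
  assumes "pushforward d f = 0"
    and "\<And>k k'. k \<in> Poly_Mapping.keys f \<Longrightarrow> k' \<in> Poly_Mapping.keys f \<Longrightarrow> d k = d k' \<Longrightarrow> g k = g k'"
  shows "pushforward g f = 0"
proof -
  define r where "r y = g (SOME k. k \<in> Poly_Mapping.keys f \<and> d k = y)" for y
  have "g k = r (d k)" if "k \<in> Poly_Mapping.keys f" for k
  proof -
    have "\<exists>k'. k' \<in> Poly_Mapping.keys f \<and> d k' = d k" using that by blast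
    from someI_ex[OF this] show ?thesis using assms(2) that unfolding r_def by metis
  qed
  then have "pushforward g f = pushforward r (pushforward d f)"
    unfolding pushforward_comp by (rule pushforward_cong)
  then show ?thesis by (simp add: assms(1))
qed

text \<open>
  The exponent of the monomial into which \<open>m\<close> turns when each variable \<open>v\<close> is replaced by a
  monomial of exponent \<open>a v\<close>.  A multiple of \<open>a v\<close> is written as a repeated sum so that exponents
  may come from any commutative monoid, for instance from a product of two exponent monoids.
\<close>

definition weight :: "('v \<Rightarrow> 'd::comm_monoid_add) \<Rightarrow> ('v \<Rightarrow>\<^sub>0 nat) \<Rightarrow> 'd" where
  "weight a m = (\<Sum>v\<in>Poly_Mapping.keys m. \<Sum>i<Poly_Mapping.lookup m v. a v)"

lemma weight_zero [simp]: "weight a 0 = 0"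
  by (simp add: weight_def)

lemma weight_add: "weight a (m + n) = weight a m + weight a n"
proof -
  have "(\<Sum>i<x + y. a v) = (\<Sum>i<x. a v) + (\<Sum>i<y. a v)" for x y :: nat and v
    by (induction y) (simp_all add: add.assoc)
  then show ?thesis unfolding weight_def by (intro setsum_keys_plus_distrib) simp_all
qed

lemma weight_single [simp]: "weight a (Poly_Mapping.single v 1) = a v"
  by (simp add: weight_def)

lemma weight_hom:
  assumes "h 0 = 0" "\<And>x y. h (x + y) = h x + h y"
  shows "h (weight a m) = weight (\<lambda>v. h (a v)) m"
proof -
  have h_sum: "h (sum b B) = (\<Sum>i\<in>B. h (b i))" for b :: "'i \<Rightarrow> _" and B
    by (induction B rule: infinite_finite_induct) (simp_all add: assms)
  show ?thesis unfolding weight_def h_sum ..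
qed

lemma weight_cong:
  "(\<And>v. v \<in> Poly_Mapping.keys m \<Longrightarrow> a v = b v) \<Longrightarrow> weight a m = weight b m"
  by (simp add: weight_def)

lemma weight_sum: "weight (\<lambda>v. \<Sum>i\<in>I. a i v) m = (\<Sum>i\<in>I. weight (a i) m)"
proof -
  have "(\<Sum>j<n. \<Sum>i\<in>I. a i v) = (\<Sum>i\<in>I. \<Sum>j<n. a i v)" for n :: nat and v by (rule sum.swap)
  then show ?thesis unfolding weight_def by (simp add: sum.swap[of _ I])
qed

section \<open>Monoid algebras and substitution of monomials\<close>

lemma monoid_alg_simps [simp]:
  "carrier (monoid_alg M) = {f. Poly_Mapping.keys f \<subseteq> M}"
  "monoid.mult (monoid_alg M) = (*)" "monoid.one (monoid_alg M) = 1"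
  "ring.zero (monoid_alg M) = 0" "ring.add (monoid_alg M) = (+)"
  "module.smult (monoid_alg M) = (\<lambda>c. Poly_Mapping.map ((*) c))"
  by (simp_all add: monoid_alg_def)

lemma lookup_scale [simp]:
  fixes c :: "'c::mult_zero"
  shows "Poly_Mapping.lookup (Poly_Mapping.map ((*) c) f) k = c * Poly_Mapping.lookup f k"
  by (simp add: Poly_Mapping.map.rep_eq when_def)

lemma keys_scale: "Poly_Mapping.keys (Poly_Mapping.map ((*) (c::'c::mult_zero)) f) \<subseteq> Poly_Mapping.keys f"
  by (auto simp: in_keys_iff)

lemma scale_single [simp]:
  fixes c :: "'c::mult_zero"
  shows "Poly_Mapping.map ((*) c) (Poly_Mapping.single k d) = Poly_Mapping.single k (c * d)"
  by (rule poly_mapping_eqI) (simp add: lookup_single when_def)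

lemma monoid_alg_cring:
  fixes M :: "'m::comm_monoid_add set"
  assumes "0 \<in> M" "\<And>x y. x \<in> M \<Longrightarrow> y \<in> M \<Longrightarrow> x + y \<in> M"
  shows "cring (monoid_alg M)"
proof (rule cringI)
  have mult_closed: "Poly_Mapping.keys (f * g) \<subseteq> M"
    if "Poly_Mapping.keys f \<subseteq> M" "Poly_Mapping.keys g \<subseteq> M" for f g :: "'m \<Rightarrow>\<^sub>0 complex"
    using keys_mult[of f g] that assms(2) by blast
  show "abelian_group (monoid_alg M)"
  proof (rule abelian_groupI)
    fix f assume f: "f \<in> carrier (monoid_alg M)"
    show "\<exists>g\<in>carrier (monoid_alg M). g \<oplus>\<^bsub>monoid_alg M\<^esub> f = \<zero>\<^bsub>monoid_alg M\<^esub>"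
      using f by (intro bexI[of _ "- f"]) simp_all
  next
    fix f g assume "f \<in> carrier (monoid_alg M)" "g \<in> carrier (monoid_alg M)"
    then show "f \<oplus>\<^bsub>monoid_alg M\<^esub> g \<in> carrier (monoid_alg M)"
      using keys_add[of f g] by auto
  qed (simp_all add: add_ac)
  show "comm_monoid (monoid_alg M)"
    by (rule comm_monoidI) (simp_all add: mult_closed mult_ac assms(1))
qed (simp add: distrib_right)

text \<open>
  Scaling by \<open>c\<close> is multiplication by \<open>c \<odot> \<one>\<close>, so the additive law of a module in its vector
  argument follows from distributivity in the ring.
\<close>

locale complex_algebra = cring A for A :: "(complex, 'b) module" (structure) +
  assumes smult_closed: "x \<in> carrier A \<Longrightarrow> c \<odot> x \<in> carrier A"
    and smult_mult: "x \<in> carrier A \<Longrightarrow> y \<in> carrier A \<Longrightarrow> (c \<odot> x) \<otimes> y = c \<odot> (x \<otimes> y)"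
begin

lemma smult_eq_mult: "x \<in> carrier A \<Longrightarrow> c \<odot> x = (c \<odot> \<one>) \<otimes> x"
  by (simp add: smult_mult)

lemma mult_smult: "x \<in> carrier A \<Longrightarrow> y \<in> carrier A \<Longrightarrow> x \<otimes> (c \<odot> y) = c \<odot> (x \<otimes> y)"
  using smult_mult[of y x c] by (simp add: m_comm smult_closed)

end

lemma monoid_alg_complex_algebra:
  assumes "0 \<in> M" "\<And>x y. x \<in> M \<Longrightarrow> y \<in> M \<Longrightarrow> x + y \<in> M"
  shows "complex_algebra (monoid_alg M)"
proof -
  interpret cring "monoid_alg M" using assms by (rule monoid_alg_cring)
  show ?thesis
  proof
    fix f :: "'a \<Rightarrow>\<^sub>0 complex" and c assume "f \<in> carrier (monoid_alg M)"
    then show "c \<odot>\<^bsub>monoid_alg M\<^esub> f \<in> carrier (monoid_alg M)"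
      using keys_scale[of c f] by auto
  qed (simp add: mult_map_scale_conv_mult mult.assoc)
qed

lemma poly_alg_complex_algebra: "complex_algebra (poly_alg V)"
  unfolding poly_alg_def
proof (rule monoid_alg_complex_algebra)
  fix m n :: "'a \<Rightarrow>\<^sub>0 nat" assume "m \<in> {m. Poly_Mapping.keys m \<subseteq> V}" "n \<in> {m. Poly_Mapping.keys m \<subseteq> V}"
  then show "m + n \<in> {m. Poly_Mapping.keys m \<subseteq> V}" using keys_add[of m n] by auto
qed simp

lemma laurent_alg_complex_algebra: "complex_algebra (laurent_alg V)"
  unfolding laurent_alg_def
proof (rule monoid_alg_complex_algebra)
  fix m n :: "'a \<Rightarrow>\<^sub>0 int" assume "m \<in> {m. Poly_Mapping.keys m \<subseteq> V}" "n \<in> {m. Poly_Mapping.keys m \<subseteq> V}"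
  then show "m + n \<in> {m. Poly_Mapping.keys m \<subseteq> V}" using keys_add[of m n] by auto
qed simp

text \<open>
  The ring \<open>G\<close> enters only through a linear map \<open>\<pi>\<close> from formal combinations that turns addition of
  exponents into multiplication.  For \<open>\<pi>\<close> the identity this computes the map that defines a toric
  ideal.  For \<open>\<pi>\<close> the projection onto a tensor product, where basis vectors are pairs of residue
  classes of monomials, it computes the map that defines a toric fiber product.  In both cases a
  substitution of monomials for variables moves coefficients along the induced map of exponents.
\<close>

lemma subst_hom_eq_pushforward:
  fixes G :: "(complex, 'b) module" and \<pi> :: "('n \<Rightarrow>\<^sub>0 complex) \<Rightarrow> 'b"
    and g :: "'d::comm_monoid_add \<Rightarrow> 'n" and a :: "'v \<Rightarrow> 'd"
  assumes G: "cring G"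
    and D: "0 \<in> D" "\<And>d d'. d \<in> D \<Longrightarrow> d' \<in> D \<Longrightarrow> d + d' \<in> D" "\<And>v. v \<in> V \<Longrightarrow> a v \<in> D"
    and closed: "\<And>u. Poly_Mapping.keys u \<subseteq> g ` D \<Longrightarrow> \<pi> u \<in> carrier G"
    and \<pi>_zero: "\<pi> 0 = \<zero>\<^bsub>G\<^esub>"
    and add: "\<And>u w. Poly_Mapping.keys u \<subseteq> g ` D \<Longrightarrow> Poly_Mapping.keys w \<subseteq> g ` D \<Longrightarrow>
      \<pi> (u + w) = \<pi> u \<oplus>\<^bsub>G\<^esub> \<pi> w"
    and \<pi>_one: "\<pi> (Poly_Mapping.single (g 0) 1) = \<one>\<^bsub>G\<^esub>"
    and mult: "\<And>d d'. d \<in> D \<Longrightarrow> d' \<in> D \<Longrightarrow>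
      \<pi> (Poly_Mapping.single (g (d + d')) 1) =
      \<pi> (Poly_Mapping.single (g d) 1) \<otimes>\<^bsub>G\<^esub> \<pi> (Poly_Mapping.single (g d') 1)"
    and smult: "\<And>c d. d \<in> D \<Longrightarrow>
      c \<odot>\<^bsub>G\<^esub> \<pi> (Poly_Mapping.single (g d) 1) = \<pi> (Poly_Mapping.single (g d) c)"
    and x: "\<And>v. v \<in> V \<Longrightarrow> x v = \<pi> (Poly_Mapping.single (g (a v)) 1)"
    and f: "\<And>m. m \<in> Poly_Mapping.keys f \<Longrightarrow> Poly_Mapping.keys m \<subseteq> V"
  shows "subst_hom G x f = \<pi> (pushforward (\<lambda>m. g (weight a m)) f)"
proof -
  interpret cring G by (rule G)
  define E where "E d = \<pi> (Poly_Mapping.single (g d) 1)" for d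
  have E_closed: "E d \<in> carrier G" if "d \<in> D" for d
    using that unfolding E_def by (intro closed) simp
  have D_sum: "sum b B \<in> D" if "\<And>i. i \<in> B \<Longrightarrow> b i \<in> D" for b :: "'i \<Rightarrow> 'd" and B
    using that by (induction B rule: infinite_finite_induct) (simp_all add: D)
  have D_mult: "(\<Sum>i<n. d) \<in> D" if "d \<in> D" for d and n :: nat
    using that by (induction n) (simp_all add: D)
  have power: "E d [^]\<^bsub>G\<^esub> n = E (\<Sum>i<n. d)" if "d \<in> D" for d and n :: nat
  proof (induction n)
    case 0
    then show ?case by (simp add: E_def \<pi>_one)
  next
    case (Suc n)
    then show ?case using mult[OF D_mult[OF that] that] by (simp add: E_def)
  qed
  have prod: "(\<Otimes>\<^bsub>G\<^esub>v\<in>B. x v [^]\<^bsub>G\<^esub> n v) = E (\<Sum>v\<in>B. \<Sum>i<n v. a v) \<and> (\<Sum>v\<in>B. \<Sum>i<n v. a v) \<in> D"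
    if "finite B" "B \<subseteq> V" for B and n :: "'v \<Rightarrow> nat"
    using that
  proof (induction B rule: finite_induct)
    case empty
    then show ?case by (simp add: E_def \<pi>_one D)
  next
    case (insert b B)
    have xp: "x v [^]\<^bsub>G\<^esub> n v = E (\<Sum>i<n v. a v)" if "v \<in> V" for v
      unfolding x[OF that] E_def[symmetric] by (rule power[OF D(3)[OF that]])
    have closed: "x v [^]\<^bsub>G\<^esub> n v \<in> carrier G" if "v \<in> V" for v
      unfolding xp[OF that] by (intro E_closed D_mult D(3) that)
    have "(\<Otimes>\<^bsub>G\<^esub>v\<in>insert b B. x v [^]\<^bsub>G\<^esub> n v) =
        x b [^]\<^bsub>G\<^esub> n b \<otimes>\<^bsub>G\<^esub> (\<Otimes>\<^bsub>G\<^esub>v\<in>B. x v [^]\<^bsub>G\<^esub> n v)"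
      using insert closed by (intro finprod_insert) auto
    also have "\<dots> = E (\<Sum>i<n b. a b) \<otimes>\<^bsub>G\<^esub> E (\<Sum>v\<in>B. \<Sum>i<n v. a v)"
      using insert xp by simp
    also have "\<dots> = E ((\<Sum>i<n b. a b) + (\<Sum>v\<in>B. \<Sum>i<n v. a v))"
      unfolding E_def using insert by (intro mult[symmetric] D_mult D(3)) auto
    finally show ?case using insert D_mult[OF D(3)] D(2) by simp
  qed
  have monomial: "(\<Otimes>\<^bsub>G\<^esub>v\<in>Poly_Mapping.keys m. x v [^]\<^bsub>G\<^esub> Poly_Mapping.lookup m v) = E (weight a m)"
    and weight_D: "weight a m \<in> D"
    if "m \<in> Poly_Mapping.keys f" for m
    using prod[OF finite_keys f[OF that]] by (simp_all add: weight_def)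
  have keys_single_D: "Poly_Mapping.keys (Poly_Mapping.single (g d) c) \<subseteq> g ` D" if "d \<in> D" for d and c :: complex
    using that by simp
  have "(\<Oplus>\<^bsub>G\<^esub>m\<in>B. Poly_Mapping.lookup f m \<odot>\<^bsub>G\<^esub> E (weight a m)) =
      \<pi> (\<Sum>m\<in>B. Poly_Mapping.single (g (weight a m)) (Poly_Mapping.lookup f m)) \<and>
      Poly_Mapping.keys (\<Sum>m\<in>B. Poly_Mapping.single (g (weight a m)) (Poly_Mapping.lookup f m)) \<subseteq> g ` D"
    if "finite B" "B \<subseteq> Poly_Mapping.keys f" for B
    using that
  proof (induction B rule: finite_induct)
    case empty
    then show ?case by (simp add: \<pi>_zero)
  next
    case (insert b B)
    let ?t = "\<lambda>m. Poly_Mapping.single (g (weight a m)) (Poly_Mapping.lookup f m)"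
    have summand: "Poly_Mapping.lookup f m \<odot>\<^bsub>G\<^esub> E (weight a m) = \<pi> (?t m)"
      and keys: "Poly_Mapping.keys (?t m) \<subseteq> g ` D" if "m \<in> insert b B" for m
      unfolding E_def using insert.prems weight_D that by (auto intro!: smult)
    have IH: "(\<Oplus>\<^bsub>G\<^esub>m\<in>B. Poly_Mapping.lookup f m \<odot>\<^bsub>G\<^esub> E (weight a m)) = \<pi> (sum ?t B)"
      "Poly_Mapping.keys (sum ?t B) \<subseteq> g ` D"
      using insert by auto
    have "(\<Oplus>\<^bsub>G\<^esub>m\<in>insert b B. Poly_Mapping.lookup f m \<odot>\<^bsub>G\<^esub> E (weight a m)) =
        Poly_Mapping.lookup f b \<odot>\<^bsub>G\<^esub> E (weight a b) \<oplus>\<^bsub>G\<^esub>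
        (\<Oplus>\<^bsub>G\<^esub>m\<in>B. Poly_Mapping.lookup f m \<odot>\<^bsub>G\<^esub> E (weight a m))"
      using insert.hyps summand closed[OF keys] by (intro finsum_insert) auto
    also have "\<dots> = \<pi> (?t b + sum ?t B)"
      using IH summand keys by (simp add: add)
    finally show ?case using insert.hyps IH(2) keys[of b] keys_add[of "?t b" "sum ?t B"] by auto
  qed
  note sum = conjunct1[OF this[OF finite_keys subset_refl]]
  have "subst_hom G x f =
      (\<Oplus>\<^bsub>G\<^esub>m\<in>Poly_Mapping.keys f. Poly_Mapping.lookup f m \<odot>\<^bsub>G\<^esub> E (weight a m))"
    unfolding subst_hom_def
  proof (rule finsum_cong'[OF refl])
    show "(\<lambda>m. Poly_Mapping.lookup f m \<odot>\<^bsub>G\<^esub> E (weight a m)) \<in> Poly_Mapping.keys f \<rightarrow> carrier G"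
      unfolding E_def using smult[OF weight_D] closed[OF keys_single_D[OF weight_D]] by auto
  qed (simp add: monomial)
  then show ?thesis unfolding sum pushforward_def .
qed

section \<open>Toric ideals as sets of polynomials with vanishing coefficient sums\<close>

definition column_exponent :: "'r set \<Rightarrow> ('r \<Rightarrow> 'k \<Rightarrow> int) \<Rightarrow> 'k \<Rightarrow> ('r \<Rightarrow>\<^sub>0 int)" where
  "column_exponent R A k = (\<Sum>r\<in>R. Poly_Mapping.single r (A r k))"

lemma keys_column_exponent: "Poly_Mapping.keys (column_exponent R A k) \<subseteq> R"
  unfolding column_exponent_def
  by (induction R rule: infinite_finite_induct) (use keys_add in \<open>fastforce split: if_splits\<close>)+

lemma lookup_column_exponent:
  "finite R \<Longrightarrow> Poly_Mapping.lookup (column_exponent R A k) r = (if r \<in> R then A r k else 0)"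
  by (simp add: column_exponent_def lookup_sum lookup_single when_def sum.delta)

text \<open>
  The map \<open>b\<close> assigns columns of the matrix to the variables.  It is the identity for the matrix of
  a tree itself, and one of the two column maps of the toric fiber product for its starred parts.
\<close>

lemma weight_column_exponent_eq_iff:
  assumes "finite R"
  shows "weight (\<lambda>v. column_exponent R A (b v)) m = weight (\<lambda>v. column_exponent R A (b v)) n \<longleftrightarrow>
    (\<forall>r\<in>R. weight (\<lambda>v. A r (b v)) m = weight (\<lambda>v. A r (b v)) n)"
proof -
  have "Poly_Mapping.lookup (weight (\<lambda>v. column_exponent R A (b v)) m) r =
      (if r \<in> R then weight (\<lambda>v. A r (b v)) m else 0)" for m r
    using weight_hom[of "\<lambda>x. Poly_Mapping.lookup x r" "\<lambda>v. column_exponent R A (b v)" m]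
    by (simp add: lookup_add lookup_column_exponent[OF assms]) (simp add: weight_def)
  then show ?thesis unfolding poly_mapping_eq_iff fun_eq_iff by auto
qed

lemma poly_alg_simps [simp]:
  "carrier (poly_alg V) = {f. \<forall>m\<in>Poly_Mapping.keys f. Poly_Mapping.keys m \<subseteq> V}"
  "monoid.mult (poly_alg V) = (*)" "monoid.one (poly_alg V) = 1"
  "ring.zero (poly_alg V) = 0" "ring.add (poly_alg V) = (+)"
  "module.smult (poly_alg V) = (\<lambda>c. Poly_Mapping.map ((*) c))"
  by (auto simp: poly_alg_def)

text \<open>
  Each monomial becomes the Laurent monomial of its degree, and distinct Laurent monomials are
  linearly independent.
\<close>

lemma toric_ideal_eq:
  "toric_ideal R K A =
     {f \<in> carrier (poly_alg K). pushforward (weight (column_exponent R A)) f = 0}"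
proof -
  interpret L: complex_algebra "laurent_alg R" by (rule laurent_alg_complex_algebra)
  have "subst_hom (laurent_alg R) (column_monomial R A) f =
      pushforward (\<lambda>m. weight (column_exponent R A) m) f"
    if "f \<in> carrier (poly_alg K)" for f
  proof (rule subst_hom_eq_pushforward[where \<pi> = "\<lambda>u. u" and g = "\<lambda>d. d"
        and D = "{d. Poly_Mapping.keys d \<subseteq> R}" and V = K])
    show "cring (laurent_alg R)" by (rule L.is_cring)
    show "Poly_Mapping.keys m \<subseteq> K" if "m \<in> Poly_Mapping.keys f" for m
      using that \<open>f \<in> carrier (poly_alg K)\<close> by simp
    show "d + d' \<in> {d. Poly_Mapping.keys d \<subseteq> R}"
      if "d \<in> {d. Poly_Mapping.keys d \<subseteq> R}" "d' \<in> {d. Poly_Mapping.keys d \<subseteq> R}" for d d'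
      using that keys_add[of d d'] by auto
    show "column_monomial R A v = Poly_Mapping.single (column_exponent R A v) 1" for v
      unfolding column_monomial_def column_exponent_def ..
  qed (simp_all add: laurent_alg_def keys_column_exponent mult_single)
  then show ?thesis
    unfolding toric_ideal_def a_kernel_def' by (auto simp: laurent_alg_def)
qed

text \<open>
  The degree is additive, so the pushforward along it is a ring homomorphism.  Its target may be
  taken to be the full group algebra, as enlarging the target does not change the kernel.
\<close>

lemma toric_ideal_is_ideal:
  fixes R :: "'r set"
  shows "ideal (toric_ideal R K A) (poly_alg K)"
proof -
  let ?L = "monoid_alg UNIV :: (complex, ('r \<Rightarrow>\<^sub>0 int) \<Rightarrow>\<^sub>0 complex) module"
  let ?d = "weight (column_exponent R A)"
  interpret P: complex_algebra "poly_alg K" by (rule poly_alg_complex_algebra)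
  interpret L: complex_algebra ?L by (rule monoid_alg_complex_algebra) simp_all
  interpret ring_hom_ring "poly_alg K" ?L "pushforward ?d"
  proof (rule ring_hom_ringI[OF P.ring_axioms L.ring_axioms])
    show "pushforward ?d \<one>\<^bsub>poly_alg K\<^esub> = \<one>\<^bsub>?L\<^esub>"
    proof -
      have "pushforward ?d (Poly_Mapping.single 0 1) = Poly_Mapping.single (?d 0) (1 :: complex)"
        by (rule pushforward_single)
      then show ?thesis by (simp only: single_one weight_zero monoid_alg_simps poly_alg_simps)
    qed
  qed (simp_all add: pushforward_add pushforward_mult weight_add)
  have "toric_ideal R K A = a_kernel (poly_alg K) ?L (pushforward ?d)"
    unfolding toric_ideal_eq a_kernel_def' by simp
  then show ?thesis using kernel_is_ideal by simp
qed

section \<open>Quotient algebras\<close>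

lemma quot_alg_simps [simp]:
  "carrier (quot_alg A I) = carrier (A Quot I)"
  "monoid.mult (quot_alg A I) = monoid.mult (A Quot I)"
  "monoid.one (quot_alg A I) = monoid.one (A Quot I)"
  "ring.zero (quot_alg A I) = ring.zero (A Quot I)"
  "ring.add (quot_alg A I) = ring.add (A Quot I)"
  by (simp_all add: quot_alg_def)

text \<open>
  The two records have different extension types, so the additive groups are not equal as records
  and the laws are carried over one at a time.
\<close>

lemma cring_quot_alg:
  assumes "cring (A Quot I)"
  shows "cring (quot_alg A I)"
proof -
  interpret quot: cring "A Quot I" by (rule assms)
  show ?thesis
  proof (rule cringI)
    show "abelian_group (quot_alg A I)"
    proof (rule abelian_groupI)
      fix C assume C: "C \<in> carrier (quot_alg A I)"
      show "\<exists>D\<in>carrier (quot_alg A I). D \<oplus>\<^bsub>quot_alg A I\<^esub> C = \<zero>\<^bsub>quot_alg A I\<^esub>"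
        using quot.l_neg[OF C[unfolded quot_alg_simps]] quot.a_inv_closed[OF C[unfolded quot_alg_simps]]
        unfolding quot_alg_simps by (rule bexI)
    qed (unfold quot_alg_simps, rule quot.a_closed quot.zero_closed quot.a_assoc quot.a_comm
        quot.l_zero; assumption)+
    show "comm_monoid (quot_alg A I)"
      by (rule comm_monoidI; unfold quot_alg_simps; rule quot.m_closed quot.one_closed
          quot.m_assoc quot.l_one quot.m_comm; assumption)
  qed (unfold quot_alg_simps, rule quot.l_distr)
qed

locale algebra_ideal = complex_algebra A + ideal I A for A :: "(complex, 'b) module" (structure) and I
begin

lemmas coset_closed = ring_hom_closed[OF rcos_ring_hom]
  and coset_mult = ring_hom_mult[OF rcos_ring_hom]
  and coset_add = ring_hom_add[OF rcos_ring_hom]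
  and coset_one = ring_hom_one[OF rcos_ring_hom]

lemma quot_elem: "C \<in> carrier (A Quot I) \<Longrightarrow> \<exists>x\<in>carrier A. C = I +> x"
  by (auto simp: FactRing_def A_RCOSETS_def')

text \<open>
  The induced scaling is a union over all representatives.  It collapses to one coset because
  scaling is multiplication by \<open>c \<odot> \<one>\<close>, which is well defined on cosets.
\<close>

lemma smult_coset:
  assumes x: "x \<in> carrier A"
  shows "c \<odot>\<^bsub>quot_alg A I\<^esub> (I +> x) = I +> (c \<odot> x)"
proof -
  have "I +> (c \<odot> y) = I +> (c \<odot> x)" if y: "y \<in> I +> x" for y
  proof -
    have y_carrier: "y \<in> carrier A" using a_r_coset_subset_G[OF a_subset x] y by blast
    have same: "I +> y = I +> x" using a_repr_independence'[OF y x] by simp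
    have eq: "I +> (c \<odot> z) = (I +> (c \<odot> \<one>)) \<otimes>\<^bsub>A Quot I\<^esub> (I +> z)" if "z \<in> carrier A" for z
      unfolding smult_eq_mult[OF that, of c] by (rule coset_mult[OF smult_closed[OF one_closed] that])
    show ?thesis unfolding eq[OF y_carrier] eq[OF x] same ..
  qed
  moreover have "x \<in> I +> x" using a_rcos_self[OF x] .
  ultimately show ?thesis unfolding quot_alg_def module.simps by blast
qed

lemma quot_complex_algebra: "complex_algebra (quot_alg A I)"
proof -
  interpret Q: cring "quot_alg A I"
    by (rule cring_quot_alg[OF quotient_is_cring[OF is_cring]])
  show ?thesis
  proof
    fix C c assume "C \<in> carrier (quot_alg A I)"
    then obtain x where x: "x \<in> carrier A" "C = I +> x"
      using quot_elem unfolding quot_alg_simps by blast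
    show "c \<odot>\<^bsub>quot_alg A I\<^esub> C \<in> carrier (quot_alg A I)"
      unfolding x(2) smult_coset[OF x(1)] quot_alg_simps by (rule coset_closed[OF smult_closed[OF x(1)]])
  next
    fix C D c assume "C \<in> carrier (quot_alg A I)" "D \<in> carrier (quot_alg A I)"
    then obtain x y where x: "x \<in> carrier A" "C = I +> x" and y: "y \<in> carrier A" "D = I +> y"
      using quot_elem unfolding quot_alg_simps by blast
    show "(c \<odot>\<^bsub>quot_alg A I\<^esub> C) \<otimes>\<^bsub>quot_alg A I\<^esub> D = c \<odot>\<^bsub>quot_alg A I\<^esub> (C \<otimes>\<^bsub>quot_alg A I\<^esub> D)"
      unfolding x(2) y(2) smult_coset[OF x(1)] quot_alg_simps
        coset_mult[OF smult_closed[OF x(1)] y(1), symmetric] coset_mult[OF x(1) y(1), symmetric]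
        smult_coset[OF m_closed[OF x(1) y(1)]] smult_mult[OF x(1) y(1)] ..
  qed
qed

end

section \<open>Linear and bilinear extensions\<close>

lemma scale_zero [simp]:
  fixes c :: complex shows "Poly_Mapping.map ((*) c) 0 = 0"
  by (rule poly_mapping_eqI) simp

lemma scale_add:
  fixes c :: complex
  shows "Poly_Mapping.map ((*) c) (f + g) = Poly_Mapping.map ((*) c) f + Poly_Mapping.map ((*) c) g"
  by (rule poly_mapping_eqI) (simp add: lookup_add distrib_left)

interpretation coefficients: Modules.module "\<lambda>c::complex. Poly_Mapping.map ((*) c)"
  by unfold_locales
    (simp_all add: poly_mapping_eq_iff fun_eq_iff lookup_add distrib_left distrib_right mult.assoc)

text \<open>
  The multiplication of the free algebra on pairs is the bilinear extension of the componentwise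
  product, and the bilinear extension of \<open>Pair\<close> is the exterior product of two combinations.
\<close>

definition bilinear_extension ::
  "('x \<Rightarrow> 'y \<Rightarrow> 'z) \<Rightarrow> ('x \<Rightarrow>\<^sub>0 complex) \<Rightarrow> ('y \<Rightarrow>\<^sub>0 complex) \<Rightarrow> ('z \<Rightarrow>\<^sub>0 complex)" where
  "bilinear_extension op f g = (\<Sum>x\<in>Poly_Mapping.keys f. \<Sum>y\<in>Poly_Mapping.keys g.
     Poly_Mapping.single (op x y) (Poly_Mapping.lookup f x * Poly_Mapping.lookup g y))"

lemma bilinear_extension_add_left:
  "bilinear_extension op (f + f') g = bilinear_extension op f g + bilinear_extension op f' g"
  unfolding bilinear_extension_def
  by (rule setsum_keys_plus_distrib) (simp_all add: distrib_right single_add sum.distrib)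

lemma bilinear_extension_add_right:
  "bilinear_extension op f (g + g') = bilinear_extension op f g + bilinear_extension op f g'"
proof -
  have "(\<Sum>y\<in>Poly_Mapping.keys (g + g'). Poly_Mapping.single (op x y)
        (c * Poly_Mapping.lookup (g + g') y)) =
      (\<Sum>y\<in>Poly_Mapping.keys g. Poly_Mapping.single (op x y) (c * Poly_Mapping.lookup g y)) +
      (\<Sum>y\<in>Poly_Mapping.keys g'. Poly_Mapping.single (op x y) (c * Poly_Mapping.lookup g' y))"
    for x c
    by (rule setsum_keys_plus_distrib) (simp_all add: distrib_left single_add)
  then show ?thesis unfolding bilinear_extension_def by (simp add: sum.distrib)
qed

lemma bilinear_extension_single [simp]:
  "bilinear_extension op (Poly_Mapping.single x c) (Poly_Mapping.single y d) =
     Poly_Mapping.single (op x y) (c * d)"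
  by (simp add: bilinear_extension_def)

lemma bilinear_extension_zero [simp]:
  "bilinear_extension op 0 g = 0" "bilinear_extension op f 0 = 0"
  by (simp_all add: bilinear_extension_def)

lemma bilinear_extension_diff_right:
  "bilinear_extension op f (g - g') = bilinear_extension op f g - bilinear_extension op f g'"
  using bilinear_extension_add_right[of op f "g - g'" g'] by simp

lemma bilinear_extension_scale_left:
  "bilinear_extension op (Poly_Mapping.map ((*) c) f) g =
     Poly_Mapping.map ((*) c) (bilinear_extension op f g)"
proof -
  have monomial: "bilinear_extension op (Poly_Mapping.map ((*) c) (Poly_Mapping.single k d)) g =
      Poly_Mapping.map ((*) c) (bilinear_extension op (Poly_Mapping.single k d) g)" for k d
  proof -
    have "Poly_Mapping.keys g \<subseteq> UNIV" by simp
    then show ?thesis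
      by (induction g rule: poly_mapping_induct_keys)
        (simp_all add: bilinear_extension_add_right scale_add mult.assoc)
  qed
  have "Poly_Mapping.keys f \<subseteq> UNIV" by simp
  then show ?thesis
  proof (induction f rule: poly_mapping_induct_keys)
    case (single k d)
    show ?case by (rule monomial)
  qed (simp_all add: bilinear_extension_add_left scale_add)
qed

lemma bilinear_extension_flip:
  "bilinear_extension op f g = bilinear_extension (\<lambda>y x. op x y) g f"
  unfolding bilinear_extension_def by (subst sum.swap) (simp add: mult.commute)

lemma bilinear_extension_scale_right:
  "bilinear_extension op f (Poly_Mapping.map ((*) c) g) =
     Poly_Mapping.map ((*) c) (bilinear_extension op f g)"
  unfolding bilinear_extension_flip[of op f] by (rule bilinear_extension_scale_left)

lemma keys_bilinear_extension:
  assumes "\<And>x y. x \<in> Poly_Mapping.keys f \<Longrightarrow> y \<in> Poly_Mapping.keys g \<Longrightarrow> op x y \<in> K"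
  shows "Poly_Mapping.keys (bilinear_extension op f g) \<subseteq> K"
proof
  fix k assume k: "k \<in> Poly_Mapping.keys (bilinear_extension op f g)"
  show "k \<in> K"
  proof (rule ccontr)
    assume "k \<notin> K"
    then have "Poly_Mapping.lookup (bilinear_extension op f g) k = 0"
      unfolding bilinear_extension_def lookup_sum
      using assms by (intro sum.neutral ballI) (auto simp: lookup_single when_def)
    then show False using k by (simp add: in_keys_iff)
  qed
qed

lemma bilinear_extension_cong:
  "(\<And>x y. x \<in> Poly_Mapping.keys f \<Longrightarrow> y \<in> Poly_Mapping.keys g \<Longrightarrow> op x y = op' x y) \<Longrightarrow>
    bilinear_extension op f g = bilinear_extension op' f g"
  by (simp add: bilinear_extension_def)

lemma bilinear_extension_assoc:
  assumes "Poly_Mapping.keys f \<subseteq> K" "Poly_Mapping.keys g \<subseteq> K" "Poly_Mapping.keys e \<subseteq> K"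
    and op: "\<And>x y z. x \<in> K \<Longrightarrow> y \<in> K \<Longrightarrow> z \<in> K \<Longrightarrow> op (op x y) z = op x (op y z)"
  shows "bilinear_extension op (bilinear_extension op f g) e =
    bilinear_extension op f (bilinear_extension op g e)"
proof -
  have 1: "bilinear_extension op (bilinear_extension op (Poly_Mapping.single x c) (Poly_Mapping.single y d)) e =
    bilinear_extension op (Poly_Mapping.single x c) (bilinear_extension op (Poly_Mapping.single y d) e)"
    if "x \<in> K" "y \<in> K" for x y c d
    using assms(3)
    by (induction e rule: poly_mapping_induct_keys)
      (simp_all add: bilinear_extension_add_right op that mult.assoc)
  have 2: "bilinear_extension op (bilinear_extension op (Poly_Mapping.single x c) g) e =
    bilinear_extension op (Poly_Mapping.single x c) (bilinear_extension op g e)"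
    if "x \<in> K" for x c
    using assms(2)
  proof (induction g rule: poly_mapping_induct_keys)
    case (single k d)
    then show ?case by (rule 1[OF that])
  qed (simp_all add: bilinear_extension_add_right bilinear_extension_add_left)
  show ?thesis
    using assms(1)
  proof (induction f rule: poly_mapping_induct_keys)
    case (single k d)
    then show ?case by (rule 2)
  qed (simp_all add: bilinear_extension_add_left)
qed

definition linear_extension :: "('x \<Rightarrow> ('z \<Rightarrow>\<^sub>0 complex)) \<Rightarrow> ('x \<Rightarrow>\<^sub>0 complex) \<Rightarrow> ('z \<Rightarrow>\<^sub>0 complex)" where
  "linear_extension \<phi> f =
     (\<Sum>x\<in>Poly_Mapping.keys f. Poly_Mapping.map ((*) (Poly_Mapping.lookup f x)) (\<phi> x))"

lemma linear_extension_zero [simp]: "linear_extension \<phi> 0 = 0"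
  by (simp add: linear_extension_def)

lemma linear_extension_add: "linear_extension \<phi> (f + g) = linear_extension \<phi> f + linear_extension \<phi> g"
  unfolding linear_extension_def
  by (rule setsum_keys_plus_distrib)
    (rule coefficients.scale_zero_left coefficients.scale_left_distrib)+

lemma linear_extension_diff: "linear_extension \<phi> (f - g) = linear_extension \<phi> f - linear_extension \<phi> g"
  using linear_extension_add[of \<phi> "f - g" g] by simp

lemma linear_extension_single [simp]:
  "linear_extension \<phi> (Poly_Mapping.single x c) = Poly_Mapping.map ((*) c) (\<phi> x)"
  by (simp add: linear_extension_def coefficients.scale_zero_left)

lemma linear_extension_scale:
  "linear_extension \<phi> (Poly_Mapping.map ((*) c) f) = Poly_Mapping.map ((*) c) (linear_extension \<phi> f)"
proof -
  have "Poly_Mapping.keys f \<subseteq> UNIV" by simp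
  then show ?thesis
    by (induction f rule: poly_mapping_induct_keys)
      (simp_all add: linear_extension_add scale_add)
qed

lemma linear_extension_pushforward:
  "linear_extension \<phi> (pushforward g f) = linear_extension (\<lambda>k. \<phi> (g k)) f"
proof -
  have "Poly_Mapping.keys f \<subseteq> UNIV" by simp
  then show ?thesis
    by (induction f rule: poly_mapping_induct_keys)
      (simp_all add: linear_extension_add pushforward_add)
qed

section \<open>Tensor products of algebras\<close>

locale algebra_pair = A: complex_algebra A + B: complex_algebra B
  for A :: "(complex, 'b) module" and B :: "(complex, 'c) module"
begin

abbreviation (input) pair_mult :: "'b \<times> 'c \<Rightarrow> 'b \<times> 'c \<Rightarrow> 'b \<times> 'c" where
  "pair_mult \<equiv> \<lambda>p q. (fst p \<otimes>\<^bsub>A\<^esub> fst q, snd p \<otimes>\<^bsub>B\<^esub> snd q)"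

lemma free_alg_simps [simp]:
  "carrier (free_alg A B) = {f. Poly_Mapping.keys f \<subseteq> carrier A \<times> carrier B}"
  "monoid.mult (free_alg A B) = bilinear_extension pair_mult"
  "monoid.one (free_alg A B) = Poly_Mapping.single (\<one>\<^bsub>A\<^esub>, \<one>\<^bsub>B\<^esub>) 1"
  "ring.zero (free_alg A B) = 0" "ring.add (free_alg A B) = (+)"
  "module.smult (free_alg A B) = (\<lambda>c. Poly_Mapping.map ((*) c))"
  by (simp_all add: free_alg_def bilinear_extension_def fun_eq_iff case_prod_beta)

lemma free_alg_complex_algebra: "complex_algebra (free_alg A B)"
proof -
  let ?K = "carrier A \<times> carrier B" and ?F = "free_alg A B"
  have mult_closed: "Poly_Mapping.keys (bilinear_extension pair_mult f g) \<subseteq> ?K"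
    if "Poly_Mapping.keys f \<subseteq> ?K" "Poly_Mapping.keys g \<subseteq> ?K" for f g
  proof (rule keys_bilinear_extension)
    fix p q assume "p \<in> Poly_Mapping.keys f" "q \<in> Poly_Mapping.keys g"
    then have "p \<in> ?K" "q \<in> ?K" using that by blast+
    then show "pair_mult p q \<in> ?K" by (simp add: mem_Times_iff)
  qed
  have mult_comm: "bilinear_extension pair_mult f g = bilinear_extension pair_mult g f"
    if "Poly_Mapping.keys f \<subseteq> ?K" "Poly_Mapping.keys g \<subseteq> ?K" for f g
  proof -
    have "bilinear_extension pair_mult f g = bilinear_extension (\<lambda>y x. pair_mult x y) g f"
      by (rule bilinear_extension_flip)
    also have "\<dots> = bilinear_extension pair_mult g f"
    proof (rule bilinear_extension_cong)
      fix p q assume "p \<in> Poly_Mapping.keys g" "q \<in> Poly_Mapping.keys f"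
      then have "p \<in> ?K" "q \<in> ?K" using that by blast+
      then show "pair_mult q p = pair_mult p q"
        using A.m_comm[of "fst p" "fst q"] B.m_comm[of "snd p" "snd q"]
        by (simp add: mem_Times_iff)
    qed
    finally show ?thesis .
  qed
  have mult_one: "bilinear_extension pair_mult (Poly_Mapping.single (\<one>\<^bsub>A\<^esub>, \<one>\<^bsub>B\<^esub>) 1) f = f"
    if "Poly_Mapping.keys f \<subseteq> ?K" for f
    using that by (induction f rule: poly_mapping_induct_keys)
      (auto simp: bilinear_extension_add_right)
  interpret F: cring ?F
  proof (rule cringI)
    show "abelian_group ?F"
    proof (rule abelian_groupI)
      fix f assume f: "f \<in> carrier ?F"
      show "\<exists>g\<in>carrier ?F. g \<oplus>\<^bsub>?F\<^esub> f = \<zero>\<^bsub>?F\<^esub>"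
        using f by (intro bexI[of _ "- f"]) simp_all
    next
      fix f g assume "f \<in> carrier ?F" "g \<in> carrier ?F"
      then show "f \<oplus>\<^bsub>?F\<^esub> g \<in> carrier ?F" using keys_add[of f g] by auto
    qed (simp_all add: add_ac)
    show "comm_monoid ?F"
    proof (rule comm_monoidI)
      fix f g e assume "f \<in> carrier ?F" "g \<in> carrier ?F" "e \<in> carrier ?F"
      then show "f \<otimes>\<^bsub>?F\<^esub> g \<otimes>\<^bsub>?F\<^esub> e = f \<otimes>\<^bsub>?F\<^esub> (g \<otimes>\<^bsub>?F\<^esub> e)"
        unfolding free_alg_simps mem_Collect_eq
        by (rule bilinear_extension_assoc) (auto simp: A.m_assoc B.m_assoc)
    next
      show "\<one>\<^bsub>?F\<^esub> \<in> carrier ?F" by simp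
    qed (simp_all only: free_alg_simps mem_Collect_eq mult_closed mult_one mult_comm)
  qed (simp only: free_alg_simps bilinear_extension_add_left)
  show ?thesis
  proof
    fix f c assume "f \<in> carrier ?F"
    then show "c \<odot>\<^bsub>?F\<^esub> f \<in> carrier ?F" using keys_scale[of c f] by auto
  qed (simp only: free_alg_simps bilinear_extension_scale_left)
qed

lemma bilinear_gens_cases:
  assumes "u \<in> bilinear_gens A B"
  obtains (add_left) a a' b where "a \<in> carrier A" "a' \<in> carrier A" "b \<in> carrier B"
      "u = Poly_Mapping.single (a \<oplus>\<^bsub>A\<^esub> a', b) 1 - Poly_Mapping.single (a, b) 1 - Poly_Mapping.single (a', b) 1"
  | (add_right) a b b' where "a \<in> carrier A" "b \<in> carrier B" "b' \<in> carrier B"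
      "u = Poly_Mapping.single (a, b \<oplus>\<^bsub>B\<^esub> b') 1 - Poly_Mapping.single (a, b) 1 - Poly_Mapping.single (a, b') 1"
  | (scale_left) c a b where "a \<in> carrier A" "b \<in> carrier B"
      "u = Poly_Mapping.single (c \<odot>\<^bsub>A\<^esub> a, b) 1 - Poly_Mapping.map ((*) c) (Poly_Mapping.single (a, b) 1)"
  | (scale_right) c a b where "a \<in> carrier A" "b \<in> carrier B"
      "u = Poly_Mapping.single (a, c \<odot>\<^bsub>B\<^esub> b) 1 - Poly_Mapping.map ((*) c) (Poly_Mapping.single (a, b) 1)"
  using assms unfolding bilinear_gens_def Let_def
  by (elim UnE; elim CollectE exE conjE)
    (erule (3) add_left, erule (3) add_right, erule (2) scale_left, erule (2) scale_right)

lemma bilinear_gensI: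
  "a \<in> carrier A \<Longrightarrow> a' \<in> carrier A \<Longrightarrow> b \<in> carrier B \<Longrightarrow>
    Poly_Mapping.single (a \<oplus>\<^bsub>A\<^esub> a', b) 1 - Poly_Mapping.single (a, b) 1 - Poly_Mapping.single (a', b) 1
      \<in> bilinear_gens A B"
  "a \<in> carrier A \<Longrightarrow> b \<in> carrier B \<Longrightarrow> b' \<in> carrier B \<Longrightarrow>
    Poly_Mapping.single (a, b \<oplus>\<^bsub>B\<^esub> b') 1 - Poly_Mapping.single (a, b) 1 - Poly_Mapping.single (a, b') 1
      \<in> bilinear_gens A B"
  "a \<in> carrier A \<Longrightarrow> b \<in> carrier B \<Longrightarrow>
    Poly_Mapping.single (c \<odot>\<^bsub>A\<^esub> a, b) 1 - Poly_Mapping.map ((*) c) (Poly_Mapping.single (a, b) 1)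
      \<in> bilinear_gens A B"
  "a \<in> carrier A \<Longrightarrow> b \<in> carrier B \<Longrightarrow>
    Poly_Mapping.single (a, c \<odot>\<^bsub>B\<^esub> b) 1 - Poly_Mapping.map ((*) c) (Poly_Mapping.single (a, b) 1)
      \<in> bilinear_gens A B"
  unfolding bilinear_gens_def Let_def
     apply (rule UnI1, rule UnI1, rule UnI1, rule CollectI, intro exI conjI, rule refl, assumption+)
    apply (rule UnI1, rule UnI1, rule UnI2, rule CollectI, intro exI conjI, rule refl, assumption+)
   apply (rule UnI1, rule UnI2, rule CollectI, intro exI conjI, rule refl, assumption+)
  apply (rule UnI2, rule CollectI, intro exI conjI, rule refl, assumption+)
  done

lemma bilinear_rels_induct [consumes 1, case_names zero add scale gen]:
  assumes "u \<in> bilinear_rels A B"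
    and "P 0" "\<And>u w. P u \<Longrightarrow> P w \<Longrightarrow> P (u + w)" "\<And>c u. P u \<Longrightarrow> P (Poly_Mapping.map ((*) c) u)"
    and "\<And>u. u \<in> bilinear_gens A B \<Longrightarrow> P u"
  shows "P u"
  using assms(1) unfolding bilinear_rels_def
proof (induction rule: coefficients.span_induct_alt)
  case base
  show ?case by (rule assms(2))
next
  case (step c x y)
  show ?case by (rule assms(3)[OF assms(4)[OF assms(5)[OF step(1)]] step(2)])
qed

lemma bilinear_rels_carrier: "bilinear_rels A B \<subseteq> carrier (free_alg A B)"
proof
  interpret F: complex_algebra "free_alg A B" by (rule free_alg_complex_algebra)
  let ?K = "carrier A \<times> carrier B"
  have single: "Poly_Mapping.keys (Poly_Mapping.single k c) \<subseteq> ?K" if "k \<in> ?K" for k and c :: complex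
    using that by simp
  have diff: "Poly_Mapping.keys (f - g) \<subseteq> ?K" if "Poly_Mapping.keys f \<subseteq> ?K" "Poly_Mapping.keys g \<subseteq> ?K"
    for f g :: "'b \<times> 'c \<Rightarrow>\<^sub>0 complex"
    using keys_diff[of f g] that by blast
  fix u assume "u \<in> bilinear_rels A B"
  then have "Poly_Mapping.keys u \<subseteq> ?K"
  proof (induction rule: bilinear_rels_induct)
    case (add u w)
    then show ?case using keys_add[of u w] by blast
  next
    case (scale c u)
    then show ?case using keys_scale[of c u] by blast
  next
    case (gen u)
    then show ?case
    proof (cases rule: bilinear_gens_cases)
      case g: (add_left a a' b)
      show ?thesis unfolding g(4) by (intro diff single SigmaI A.a_closed g(1-3))
    next
      case g: (add_right a b b')
      show ?thesis unfolding g(4) by (intro diff single SigmaI B.a_closed g(1-3))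
    next
      case g: (scale_left c a b)
      show ?thesis unfolding g(3) scale_single by (intro diff single SigmaI A.smult_closed g(1,2))
    next
      case g: (scale_right c a b)
      show ?thesis unfolding g(3) scale_single by (intro diff single SigmaI B.smult_closed g(1,2))
    qed
  qed simp
  then show "u \<in> carrier (free_alg A B)" by simp
qed

text \<open>
  Multiplying a bilinearity relation by a basis vector \<open>(a0, b0)\<close> gives the same kind of relation
  between the products with \<open>a0\<close> and \<open>b0\<close>.  Linearity in both factors does the rest.
\<close>

lemma bilinear_rels_mult:
  assumes f: "f \<in> carrier (free_alg A B)" and u: "u \<in> bilinear_rels A B"
  shows "bilinear_extension pair_mult f u \<in> bilinear_rels A B"
proof -
  have span: "bilinear_rels A B = coefficients.span (bilinear_gens A B)" by (rule bilinear_rels_def)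
  have monomial: "bilinear_extension pair_mult (Poly_Mapping.single (a0, b0) d) u \<in> bilinear_rels A B"
    if k: "a0 \<in> carrier A" "b0 \<in> carrier B" for a0 b0 d
    using u
  proof (induction rule: bilinear_rels_induct)
    case zero
    show ?case unfolding span by (simp add: coefficients.span_zero)
  next
    case (add u w)
    then show ?case unfolding span bilinear_extension_add_right by (rule coefficients.span_add)
  next
    case (scale c u)
    then show ?case unfolding span bilinear_extension_scale_right by (rule coefficients.span_scale)
  next
    case (gen u)
    have d: "Poly_Mapping.single p d = Poly_Mapping.map ((*) d) (Poly_Mapping.single p 1)" for p :: "'b \<times> 'c"
      by simp
    have "\<exists>w\<in>bilinear_gens A B. bilinear_extension pair_mult (Poly_Mapping.single (a0, b0) 1) u = w"
      using gen
    proof (cases rule: bilinear_gens_cases)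
      case g: (add_left a a' b)
      show ?thesis
        using bilinear_gensI(1)[of "a0 \<otimes>\<^bsub>A\<^esub> a" "a0 \<otimes>\<^bsub>A\<^esub> a'" "b0 \<otimes>\<^bsub>B\<^esub> b"] g k
        by (simp add: g(4) bilinear_extension_diff_right A.r_distr)
    next
      case g: (add_right a b b')
      show ?thesis
        using bilinear_gensI(2)[of "a0 \<otimes>\<^bsub>A\<^esub> a" "b0 \<otimes>\<^bsub>B\<^esub> b" "b0 \<otimes>\<^bsub>B\<^esub> b'"] g k
        by (simp add: g(4) bilinear_extension_diff_right B.r_distr)
    next
      case g: (scale_left c a b)
      show ?thesis
        using bilinear_gensI(3)[of "a0 \<otimes>\<^bsub>A\<^esub> a" "b0 \<otimes>\<^bsub>B\<^esub> b" c] g k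
        by (simp add: g(3) bilinear_extension_diff_right A.mult_smult)
    next
      case g: (scale_right c a b)
      show ?thesis
        using bilinear_gensI(4)[of "a0 \<otimes>\<^bsub>A\<^esub> a" "b0 \<otimes>\<^bsub>B\<^esub> b" c] g k
        by (simp add: g(3) bilinear_extension_diff_right B.mult_smult)
    qed
    then have "bilinear_extension pair_mult (Poly_Mapping.single (a0, b0) 1) u \<in> bilinear_rels A B"
      unfolding span using coefficients.span_base by blast
    then show ?case
      unfolding span d[of "(a0, b0)"] bilinear_extension_scale_left by (rule coefficients.span_scale)
  qed
  have "Poly_Mapping.keys f \<subseteq> carrier A \<times> carrier B" using f by simp
  then show ?thesis
  proof (induction f rule: poly_mapping_induct_keys)
    case zero
    show ?case unfolding span by (simp add: coefficients.span_zero)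
  next
    case (single k c)
    then show ?case using monomial[of "fst k" "snd k" c] by (simp add: mem_Times_iff)
  next
    case (add f g)
    then show ?case unfolding span bilinear_extension_add_left by (intro coefficients.span_add)
  qed
qed

lemma bilinear_rels_ideal: "ideal (bilinear_rels A B) (free_alg A B)"
proof -
  interpret F: complex_algebra "free_alg A B" by (rule free_alg_complex_algebra)
  have span: "bilinear_rels A B = coefficients.span (bilinear_gens A B)" by (rule bilinear_rels_def)
  show ?thesis
  proof (rule idealI[OF F.ring_axioms])
    show "subgroup (bilinear_rels A B) (add_monoid (free_alg A B))"
    proof (rule F.add.subgroupI[OF bilinear_rels_carrier])
      show "bilinear_rels A B \<noteq> {}" unfolding span using coefficients.span_zero by blast
    next
      fix u assume u: "u \<in> bilinear_rels A B"
      then have "u \<in> carrier (free_alg A B)" using bilinear_rels_carrier by blast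
      then have "\<ominus>\<^bsub>free_alg A B\<^esub> u = - u" by (intro F.minus_equality) simp_all
      then show "\<ominus>\<^bsub>free_alg A B\<^esub> u \<in> bilinear_rels A B"
        using u coefficients.span_neg unfolding span by simp
    next
      fix u w assume "u \<in> bilinear_rels A B" "w \<in> bilinear_rels A B"
      then show "u \<oplus>\<^bsub>free_alg A B\<^esub> w \<in> bilinear_rels A B"
        unfolding span free_alg_simps by (rule coefficients.span_add)
    qed
  next
    fix u f assume u: "u \<in> bilinear_rels A B" and f: "f \<in> carrier (free_alg A B)"
    show "f \<otimes>\<^bsub>free_alg A B\<^esub> u \<in> bilinear_rels A B"
      unfolding free_alg_simps by (rule bilinear_rels_mult[OF f u])
    then show "u \<otimes>\<^bsub>free_alg A B\<^esub> f \<in> bilinear_rels A B"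
      using F.m_comm[OF f subsetD[OF bilinear_rels_carrier u]] by simp
  qed
qed

text \<open>
  A bilinear map on pairs induces a linear map on the tensor product.
\<close>

lemma linear_extension_bilinear_rels:
  assumes \<phi>: "\<And>a a' b. a \<in> carrier A \<Longrightarrow> a' \<in> carrier A \<Longrightarrow> b \<in> carrier B \<Longrightarrow>
      \<phi> (a \<oplus>\<^bsub>A\<^esub> a', b) = \<phi> (a, b) + \<phi> (a', b)"
    "\<And>a b b'. a \<in> carrier A \<Longrightarrow> b \<in> carrier B \<Longrightarrow> b' \<in> carrier B \<Longrightarrow>
      \<phi> (a, b \<oplus>\<^bsub>B\<^esub> b') = \<phi> (a, b) + \<phi> (a, b')"
    "\<And>c a b. a \<in> carrier A \<Longrightarrow> b \<in> carrier B \<Longrightarrow>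
      \<phi> (c \<odot>\<^bsub>A\<^esub> a, b) = Poly_Mapping.map ((*) c) (\<phi> (a, b))"
    "\<And>c a b. a \<in> carrier A \<Longrightarrow> b \<in> carrier B \<Longrightarrow>
      \<phi> (a, c \<odot>\<^bsub>B\<^esub> b) = Poly_Mapping.map ((*) c) (\<phi> (a, b))"
    and u: "u \<in> bilinear_rels A B"
  shows "linear_extension \<phi> u = 0"
  using u
proof (induction rule: bilinear_rels_induct)
  case (gen u)
  then show ?case
    by (cases rule: bilinear_gens_cases)
      (simp_all add: \<phi> linear_extension_diff linear_extension_scale coefficients.scale_one)
qed (simp_all add: linear_extension_add linear_extension_scale)

end

section \<open>Monomial maps into tensor products of toric rings\<close>

text \<open>
  The difference of the two polynomials lies in the toric ideal by its description through
  coefficient sums.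
\<close>

lemma toric_coset_eq:
  assumes f: "f \<in> carrier (poly_alg K)" and f': "f' \<in> carrier (poly_alg K)"
    and eq: "pushforward (weight (column_exponent R A)) f = pushforward (weight (column_exponent R A)) f'"
  shows "toric_ideal R K A +>\<^bsub>poly_alg K\<^esub> f = toric_ideal R K A +>\<^bsub>poly_alg K\<^esub> f'"
proof -
  interpret P: complex_algebra "poly_alg K" by (rule poly_alg_complex_algebra)
  interpret P: algebra_ideal "poly_alg K" "toric_ideal R K A"
    by (intro algebra_ideal.intro poly_alg_complex_algebra toric_ideal_is_ideal)
  have "f - f' \<in> toric_ideal R K A"
    unfolding toric_ideal_eq using f f' keys_diff[of f f'] eq by (auto simp: pushforward_diff)
  then have "f \<in> toric_ideal R K A +>\<^bsub>poly_alg K\<^esub> f'"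
    unfolding a_r_coset_def' by (intro UN_I[of "f - f'"]) simp_all
  from P.a_repr_independence'[OF this f'] show ?thesis by (rule sym)
qed

text \<open>
  The injective map from the residue class ring of a toric ideal to the group algebra.  Any
  representative may be chosen, see \<open>toric_value_coset\<close>.
\<close>

definition toric_value :: "'r set \<Rightarrow> ('r \<Rightarrow> 'k \<Rightarrow> int) \<Rightarrow> (('k \<Rightarrow>\<^sub>0 nat) \<Rightarrow>\<^sub>0 complex) set \<Rightarrow>
    ('r \<Rightarrow>\<^sub>0 int) \<Rightarrow>\<^sub>0 complex" where
  "toric_value R A C = pushforward (weight (column_exponent R A)) (SOME f. f \<in> C)"

lemma toric_value_coset:
  assumes f: "f \<in> carrier (poly_alg K)"
  shows "toric_value R A (toric_ideal R K A +>\<^bsub>poly_alg K\<^esub> f) =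
    pushforward (weight (column_exponent R A)) f"
proof -
  let ?I = "toric_ideal R K A"
  have "0 + f \<in> ?I +>\<^bsub>poly_alg K\<^esub> f"
    unfolding a_r_coset_def' by (intro UN_I[of 0]) (simp_all add: toric_ideal_eq)
  then have "(SOME f'. f' \<in> ?I +>\<^bsub>poly_alg K\<^esub> f) \<in> ?I +>\<^bsub>poly_alg K\<^esub> f" by (rule someI)
  then obtain i where "i \<in> ?I" "(SOME f'. f' \<in> ?I +>\<^bsub>poly_alg K\<^esub> f) = i + f"
    unfolding a_r_coset_def' by auto
  then show ?thesis unfolding toric_value_def by (simp add: pushforward_add toric_ideal_eq)
qed

lemma toric_value_linear:
  fixes R :: "'r set" and A :: "'r \<Rightarrow> 'k \<Rightarrow> int" and K :: "'k set"
  defines "Q \<equiv> quot_alg (poly_alg K) (toric_ideal R K A)"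
  assumes C: "C \<in> carrier Q"
  shows "D \<in> carrier Q \<Longrightarrow> toric_value R A (C \<oplus>\<^bsub>Q\<^esub> D) = toric_value R A C + toric_value R A D"
    and "toric_value R A (c \<odot>\<^bsub>Q\<^esub> C) = Poly_Mapping.map ((*) c) (toric_value R A C)"
proof -
  interpret P: algebra_ideal "poly_alg K" "toric_ideal R K A"
    by (intro algebra_ideal.intro poly_alg_complex_algebra toric_ideal_is_ideal)
  let ?I = "toric_ideal R K A" and ?d = "weight (column_exponent R A)"
  obtain f where f: "f \<in> carrier (poly_alg K)" "C = ?I +>\<^bsub>poly_alg K\<^esub> f"
    using P.quot_elem[OF C[unfolded Q_def quot_alg_simps]] by blast
  show "toric_value R A (C \<oplus>\<^bsub>Q\<^esub> D) = toric_value R A C + toric_value R A D"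
    if D: "D \<in> carrier Q"
  proof -
    obtain g where g: "g \<in> carrier (poly_alg K)" "D = ?I +>\<^bsub>poly_alg K\<^esub> g"
      using P.quot_elem[OF D[unfolded Q_def quot_alg_simps]] by blast
    have "C \<oplus>\<^bsub>Q\<^esub> D = ?I +>\<^bsub>poly_alg K\<^esub> (f \<oplus>\<^bsub>poly_alg K\<^esub> g)"
      unfolding Q_def quot_alg_simps f(2) g(2) by (rule P.coset_add[OF f(1) g(1), symmetric])
    moreover have sum: "f + g \<in> carrier (poly_alg K)"
      using P.add.m_closed[OF f(1) g(1)] unfolding poly_alg_simps(5) .
    ultimately show ?thesis
      unfolding f(2) g(2) toric_value_coset[OF f(1)] toric_value_coset[OF g(1)]
      by (simp only: poly_alg_simps(5) toric_value_coset[OF sum] pushforward_add)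
  qed
  have scale: "pushforward ?d (Poly_Mapping.map ((*) c) f) = Poly_Mapping.map ((*) c) (pushforward ?d f)"
  proof -
    have "Poly_Mapping.keys f \<subseteq> UNIV" by simp
    then show ?thesis
      by (induction f rule: poly_mapping_induct_keys) (simp_all add: scale_add pushforward_add)
  qed
  have scaled: "Poly_Mapping.map ((*) c) f \<in> carrier (poly_alg K)"
    using P.smult_closed[OF f(1)] unfolding poly_alg_simps(6) .
  show "toric_value R A (c \<odot>\<^bsub>Q\<^esub> C) = Poly_Mapping.map ((*) c) (toric_value R A C)"
    unfolding Q_def f(2) P.smult_coset[OF f(1)] poly_alg_simps(6) toric_value_coset[OF f(1)]
      toric_value_coset[OF scaled] scale ..
qed

text \<open>
  The residue class of a monomial depends only on its degree, hence so does the pure tensor that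
  is the image of a monomial in the \<open>p\<close> variables: if the coefficients sum to zero over each set of
  monomials with equal pairs of degrees, the image is already zero as a formal combination of
  pairs.  Conversely, the bilinear map that sends a pair of residue classes to the exterior product
  of their \<open>toric_value\<close>s vanishes on all bilinearity relations.  It sends the pure tensor of two
  monomials to the basis vector of their pair of degrees, and so recovers the coefficient sums from
  the image.
\<close>

lemma kernel_of_monomial_tensors:
  fixes R1 :: "'r set" and A1 :: "'r \<Rightarrow> 'k \<Rightarrow> int" and R2 :: "'s set" and A2 :: "'s \<Rightarrow> 'l \<Rightarrow> int"
    and K1 :: "'k set" and K2 :: "'l set" and P :: "'v set"
  defines "I \<equiv> toric_ideal R1 K1 A1" and "J \<equiv> toric_ideal R2 K2 A2"
  defines "Q \<equiv> quot_alg (poly_alg K1) I" and "W \<equiv> quot_alg (poly_alg K2) J"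
  assumes \<alpha>: "\<And>c. c \<in> P \<Longrightarrow> \<alpha> c \<in> K1" and \<beta>: "\<And>c. c \<in> P \<Longrightarrow> \<beta> c \<in> K2"
    and x: "\<And>c. c \<in> P \<Longrightarrow> x c = pure_tensor Q W
      (I +>\<^bsub>poly_alg K1\<^esub> poly_var (\<alpha> c)) (J +>\<^bsub>poly_alg K2\<^esub> poly_var (\<beta> c))"
  shows "a_kernel (poly_alg P) (tensor_alg Q W) (subst_hom (tensor_alg Q W) x) =
    {f \<in> carrier (poly_alg P). pushforward (\<lambda>m.
      (weight (\<lambda>c. column_exponent R1 A1 (\<alpha> c)) m, weight (\<lambda>c. column_exponent R2 A2 (\<beta> c)) m)) f = 0}"
proof -
  interpret P1: algebra_ideal "poly_alg K1" I
    unfolding I_def by (intro algebra_ideal.intro poly_alg_complex_algebra toric_ideal_is_ideal)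
  interpret P2: algebra_ideal "poly_alg K2" J
    unfolding J_def by (intro algebra_ideal.intro poly_alg_complex_algebra toric_ideal_is_ideal)
  interpret QW: algebra_pair Q W
    unfolding Q_def W_def by (intro algebra_pair.intro P1.quot_complex_algebra P2.quot_complex_algebra)
  let ?F = "free_alg Q W" and ?U = "bilinear_rels Q W"
  interpret F: algebra_ideal ?F ?U
    by (intro algebra_ideal.intro QW.free_alg_complex_algebra QW.bilinear_rels_ideal)
  let ?d1 = "weight (column_exponent R1 A1)" and ?d2 = "weight (column_exponent R2 A2)"
  \<comment> \<open>A pair \<open>d\<close> of exponents stands for the tensor product of two monomials: \<open>g d\<close> is its pair of
    residue classes, \<open>a c\<close> is the pair for the image of the variable \<open>c\<close>, and \<open>M\<close> restricts to the
    variables of the two polynomial rings.\<close>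
  define g where "g d = (I +>\<^bsub>poly_alg K1\<^esub> Poly_Mapping.single (fst d) 1,
      J +>\<^bsub>poly_alg K2\<^esub> Poly_Mapping.single (snd d) 1)" for d :: "('k \<Rightarrow>\<^sub>0 nat) \<times> ('l \<Rightarrow>\<^sub>0 nat)"
  define a where "a c = (Poly_Mapping.single (\<alpha> c) (1::nat), Poly_Mapping.single (\<beta> c) (1::nat))" for c
  define M where "M = {d :: ('k \<Rightarrow>\<^sub>0 nat) \<times> ('l \<Rightarrow>\<^sub>0 nat).
      Poly_Mapping.keys (fst d) \<subseteq> K1 \<and> Poly_Mapping.keys (snd d) \<subseteq> K2}"
  have M_zero: "0 \<in> M" by (simp add: M_def)
  have M_add: "d + d' \<in> M" if "d \<in> M" "d' \<in> M" for d d'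
    using that keys_add[of "fst d" "fst d'"] keys_add[of "snd d" "snd d'"] unfolding M_def by auto
  have mono1: "Poly_Mapping.single (fst d) (c::complex) \<in> carrier (poly_alg K1)"
    and mono2: "Poly_Mapping.single (snd d) (c::complex) \<in> carrier (poly_alg K2)" if "d \<in> M" for d c
    using that by (simp_all add: M_def)
  have g_carrier: "g d \<in> carrier Q \<times> carrier W" if "d \<in> M" for d
    unfolding g_def Q_def W_def quot_alg_simps
    by (intro SigmaI P1.coset_closed P2.coset_closed mono1 mono2 that)
  have g_zero: "g 0 = (\<one>\<^bsub>Q\<^esub>, \<one>\<^bsub>W\<^esub>)"
    unfolding g_def Q_def W_def quot_alg_simps
    using P1.coset_one P2.coset_one by simp
  have g_add: "g (d + d') = (fst (g d) \<otimes>\<^bsub>Q\<^esub> fst (g d'), snd (g d) \<otimes>\<^bsub>W\<^esub> snd (g d'))"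
    if "d \<in> M" "d' \<in> M" for d d'
    using P1.coset_mult[OF mono1[OF that(1), of 1] mono1[OF that(2), of 1]]
      P2.coset_mult[OF mono2[OF that(1), of 1] mono2[OF that(2), of 1]]
    unfolding g_def Q_def W_def quot_alg_simps by (simp add: mult_single)
  have keys_carrier: "u \<in> carrier ?F" if "Poly_Mapping.keys u \<subseteq> g ` M" for u
    using that g_carrier unfolding QW.free_alg_simps by blast
  have single_carrier: "Poly_Mapping.single (g d) c \<in> carrier ?F" if "d \<in> M" for d c
    by (rule keys_carrier) (use that in simp)
  have tensor: "tensor_alg Q W = quot_alg ?F ?U" by (rule tensor_alg_def)
  have subst: "subst_hom (tensor_alg Q W) x f = ?U +>\<^bsub>?F\<^esub> pushforward (\<lambda>m. g (weight a m)) f"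
    if f: "f \<in> carrier (poly_alg P)" for f
    unfolding tensor
  proof (rule subst_hom_eq_pushforward[where D = M and V = P and \<pi> = "\<lambda>u. ?U +>\<^bsub>?F\<^esub> u"])
    show "cring (quot_alg ?F ?U)"
      using F.quot_complex_algebra by (rule complex_algebra.axioms(1))
    show "0 \<in> M" "\<And>d d'. d \<in> M \<Longrightarrow> d' \<in> M \<Longrightarrow> d + d' \<in> M" by (fact M_zero, fact M_add)
    show "a v \<in> M" if "v \<in> P" for v using \<alpha>[OF that] \<beta>[OF that] by (simp add: a_def M_def)
    show "?U +>\<^bsub>?F\<^esub> u \<in> carrier (quot_alg ?F ?U)" if "Poly_Mapping.keys u \<subseteq> g ` M" for u
      unfolding quot_alg_simps by (rule F.coset_closed[OF keys_carrier[OF that]])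
    show "?U +>\<^bsub>?F\<^esub> 0 = \<zero>\<^bsub>quot_alg ?F ?U\<^esub>"
      using F.a_coset_add_zero[OF F.a_subset] by (simp add: FactRing_def)
    show "?U +>\<^bsub>?F\<^esub> (u + w) = (?U +>\<^bsub>?F\<^esub> u) \<oplus>\<^bsub>quot_alg ?F ?U\<^esub> (?U +>\<^bsub>?F\<^esub> w)"
      if "Poly_Mapping.keys u \<subseteq> g ` M" "Poly_Mapping.keys w \<subseteq> g ` M" for u w
      using F.coset_add[OF keys_carrier[OF that(1)] keys_carrier[OF that(2)]]
      by (simp only: quot_alg_simps QW.free_alg_simps)
    show "?U +>\<^bsub>?F\<^esub> Poly_Mapping.single (g 0) 1 = \<one>\<^bsub>quot_alg ?F ?U\<^esub>"
      using F.coset_one by (simp only: quot_alg_simps QW.free_alg_simps g_zero)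
    show "?U +>\<^bsub>?F\<^esub> Poly_Mapping.single (g (d + d')) 1 =
        (?U +>\<^bsub>?F\<^esub> Poly_Mapping.single (g d) 1) \<otimes>\<^bsub>quot_alg ?F ?U\<^esub> (?U +>\<^bsub>?F\<^esub> Poly_Mapping.single (g d') 1)"
      if "d \<in> M" "d' \<in> M" for d d'
    proof -
      have "Poly_Mapping.single (g d) 1 \<in> carrier ?F" "Poly_Mapping.single (g d') 1 \<in> carrier ?F"
        by (rule single_carrier[OF that(1)], rule single_carrier[OF that(2)])
      from F.coset_mult[OF this] show ?thesis
        by (simp only: quot_alg_simps QW.free_alg_simps bilinear_extension_single g_add[OF that] mult_1)
    qed
    show "c \<odot>\<^bsub>quot_alg ?F ?U\<^esub> (?U +>\<^bsub>?F\<^esub> Poly_Mapping.single (g d) 1) = ?U +>\<^bsub>?F\<^esub> Poly_Mapping.single (g d) c"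
      if "d \<in> M" for c d
    proof -
      have "Poly_Mapping.single (g d) 1 \<in> carrier ?F"
        by (rule single_carrier[OF that])
      from F.smult_coset[OF this, of c] show ?thesis
        by (simp only: QW.free_alg_simps scale_single mult_1_right)
    qed
    show "x v = ?U +>\<^bsub>?F\<^esub> Poly_Mapping.single (g (a v)) 1" if "v \<in> P" for v
      unfolding x[OF that] pure_tensor_def g_def a_def poly_var_def fst_conv snd_conv ..
    show "Poly_Mapping.keys m \<subseteq> P" if "m \<in> Poly_Mapping.keys f" for m
      using f that by simp
  qed
  have weight_M: "weight a m \<in> M" if "Poly_Mapping.keys m \<subseteq> P" for m
  proof -
    have "sum b B \<in> M" if "\<And>i. i \<in> B \<Longrightarrow> b i \<in> M" for b :: "'i \<Rightarrow> _" and B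
      using that by (induction B rule: infinite_finite_induct) (simp_all add: M_zero M_add)
    note sum_v = this
    have power: "(\<Sum>i<n. a v) \<in> M" if "v \<in> P" for n :: nat and v
      by (rule sum_v) (use \<alpha>[OF that] \<beta>[OF that] in \<open>simp add: a_def M_def\<close>)
    show ?thesis unfolding weight_def by (rule sum_v, rule power) (use that in blast)
  qed
  have degree1: "?d1 (fst (weight a m)) = weight (\<lambda>c. column_exponent R1 A1 (\<alpha> c)) m"
    and degree2: "?d2 (snd (weight a m)) = weight (\<lambda>c. column_exponent R2 A2 (\<beta> c)) m" for m
    using weight_hom[of fst a m] weight_hom[of snd a m]
      weight_hom[of ?d1 "\<lambda>c. Poly_Mapping.single (\<alpha> c) 1" m]
      weight_hom[of ?d2 "\<lambda>c. Poly_Mapping.single (\<beta> c) 1" m]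
    by (simp_all add: a_def weight_add weight_single[unfolded One_nat_def])
  define pair where "pair d = (?d1 (fst d), ?d2 (snd d))" for d
  have pair: "pair (weight a m) = (weight (\<lambda>c. column_exponent R1 A1 (\<alpha> c)) m,
      weight (\<lambda>c. column_exponent R2 A2 (\<beta> c)) m)" for m
    unfolding pair_def degree1 degree2 ..
  define \<phi> where "\<phi> p = bilinear_extension Pair (toric_value R1 A1 (fst p)) (toric_value R2 A2 (snd p))" for p
  have \<phi>_rels: "linear_extension \<phi> u = 0" if "u \<in> ?U" for u
  proof (rule QW.linear_extension_bilinear_rels[OF _ _ _ _ that])
    show "\<phi> (C \<oplus>\<^bsub>Q\<^esub> C', D) = \<phi> (C, D) + \<phi> (C', D)" if "C \<in> carrier Q" "C' \<in> carrier Q" for C C' D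
      using toric_value_linear(1)[OF that[unfolded Q_def I_def]]
      unfolding \<phi>_def Q_def I_def by (simp add: bilinear_extension_add_left)
    show "\<phi> (C, D \<oplus>\<^bsub>W\<^esub> D') = \<phi> (C, D) + \<phi> (C, D')" if "D \<in> carrier W" "D' \<in> carrier W" for C D D'
      using toric_value_linear(1)[OF that[unfolded W_def J_def]]
      unfolding \<phi>_def W_def J_def by (simp add: bilinear_extension_add_right)
    show "\<phi> (c \<odot>\<^bsub>Q\<^esub> C, D) = Poly_Mapping.map ((*) c) (\<phi> (C, D))" if "C \<in> carrier Q" for c C D
      using toric_value_linear(2)[OF that[unfolded Q_def I_def]]
      unfolding \<phi>_def Q_def I_def by (simp add: bilinear_extension_scale_left)
    show "\<phi> (C, c \<odot>\<^bsub>W\<^esub> D) = Poly_Mapping.map ((*) c) (\<phi> (C, D))" if "D \<in> carrier W" for c C D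
      using toric_value_linear(2)[OF that[unfolded W_def J_def]]
      unfolding \<phi>_def W_def J_def by (simp add: bilinear_extension_scale_right)
  qed
  have \<phi>_g: "\<phi> (g d) = Poly_Mapping.single (pair d) 1" if "d \<in> M" for d
    unfolding \<phi>_def g_def pair_def I_def J_def fst_conv snd_conv
      toric_value_coset[OF mono1[OF that]] toric_value_coset[OF mono2[OF that]] by simp
  have "subst_hom (tensor_alg Q W) x f = \<zero>\<^bsub>tensor_alg Q W\<^esub> \<longleftrightarrow>
      pushforward (\<lambda>m. pair (weight a m)) f = 0" if f: "f \<in> carrier (poly_alg P)" for f
  proof -
    have keys_f: "weight a m \<in> M" if "m \<in> Poly_Mapping.keys f" for m
      using f that by (intro weight_M) simp
    let ?u = "pushforward (\<lambda>m. g (weight a m)) f"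
    have "Poly_Mapping.keys ?u \<subseteq> g ` M"
    proof -
      have "Poly_Mapping.lookup ?u p = 0" if "p \<notin> g ` M" for p
        unfolding pushforward_def lookup_sum
        using that keys_f by (intro sum.neutral ballI) (auto simp: lookup_single when_def)
      then show ?thesis by (auto simp: in_keys_iff)
    qed
    then have u: "?u \<in> carrier ?F" by (rule keys_carrier)
    have zero: "\<zero>\<^bsub>tensor_alg Q W\<^esub> = ?U" unfolding tensor by (simp add: FactRing_def)
    show ?thesis
      unfolding subst[OF f] zero
    proof
      assume "?U +>\<^bsub>?F\<^esub> ?u = ?U"
      then have "?u \<in> ?U" using F.a_rcos_self[OF u] by simp
      then have "linear_extension (\<lambda>m. \<phi> (g (weight a m))) f = 0"
        using \<phi>_rels[of ?u] unfolding linear_extension_pushforward by simp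
      then show "pushforward (\<lambda>m. pair (weight a m)) f = 0"
        unfolding linear_extension_def pushforward_def using \<phi>_g[OF keys_f] by simp
    next
      assume "pushforward (\<lambda>m. pair (weight a m)) f = 0"
      then have "?u = 0"
      proof (rule pushforward_eq_0_transfer)
        fix m m' assume m: "m \<in> Poly_Mapping.keys f" "m' \<in> Poly_Mapping.keys f"
          and eq: "pair (weight a m) = pair (weight a m')"
        note mM = keys_f[OF m(1)] keys_f[OF m(2)]
        have "?d1 (fst (weight a m)) = ?d1 (fst (weight a m'))" "?d2 (snd (weight a m)) = ?d2 (snd (weight a m'))"
          using eq by (simp_all add: pair_def)
        then show "g (weight a m) = g (weight a m')"
          using toric_coset_eq[OF mono1[OF mM(1)] mono1[OF mM(2)], of R1 A1 1 1]
            toric_coset_eq[OF mono2[OF mM(1)] mono2[OF mM(2)], of R2 A2 1 1]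
          unfolding g_def I_def J_def by simp
      qed
      then show "?U +>\<^bsub>?F\<^esub> ?u = ?U"
        using F.a_coset_add_zero[OF F.a_subset] by simp
    qed
  qed
  then show ?thesis unfolding a_kernel_def' pair by blast
qed

section \<open>Walks and cuts\<close>

lemma pcas_append: "pcas u (p @ q) w \<longleftrightarrow> (\<exists>v. pcas u p v \<and> pcas v q w)"
  by (induction p arbitrary: u) auto

lemma pcas_reverse: "pcas u p v \<Longrightarrow> pcas v (rev (map prod.swap p)) u"
  by (induction p arbitrary: u) (auto simp: pcas_append)

lemma awalk_with_proj:
  "pre_digraph.awalk (with_proj G) u p v \<longleftrightarrow> u \<in> pverts G \<and> set p \<subseteq> parcs G \<and> pcas u p v"
  by (simp add: pre_digraph.awalk_def cas_with_proj_eq)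

lemma parcs_symmetric_closure:
  "parcs (mk_symmetric (with_proj G)) = parcs G \<union> (parcs G)\<inverse>"
  by (auto simp: parcs_mk_symmetric)

definition undirected_walk :: "'a rtree \<Rightarrow> 'a \<Rightarrow> ('a \<times> 'a) list \<Rightarrow> 'a \<Rightarrow> bool" where
  "undirected_walk T = pre_digraph.awalk (with_proj (mk_symmetric (with_proj (tree_graph T))))"

lemma undirected_walk_iff:
  "undirected_walk T u p v \<longleftrightarrow>
     u \<in> pverts (tree_graph T) \<and>
     set p \<subseteq> parcs (tree_graph T) \<union> (parcs (tree_graph T))\<inverse> \<and> pcas u p v"
  by (simp add: undirected_walk_def awalk_with_proj parcs_symmetric_closure)

definition linked :: "'a rtree \<Rightarrow> 'a \<Rightarrow> 'a \<Rightarrow> bool" where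
  "linked T u v \<longleftrightarrow> (\<exists>p. undirected_walk T u p v)"

lemma linked_trans:
  assumes "linked T u v" "linked T v w"
  shows "linked T u w"
proof -
  obtain p q where "undirected_walk T u p v" "undirected_walk T v q w"
    using assms unfolding linked_def by blast
  then have "undirected_walk T u (p @ q) w"
    unfolding undirected_walk_iff pcas_append by auto
  then show ?thesis unfolding linked_def by blast
qed

lemma linked_sym:
  assumes "linked T u v" "v \<in> pverts (tree_graph T)"
  shows "linked T v u"
proof -
  obtain p where "set p \<subseteq> parcs (tree_graph T) \<union> (parcs (tree_graph T))\<inverse>" "pcas u p v"
    using assms by (auto simp: linked_def undirected_walk_iff)
  then have "undirected_walk T v (rev (map prod.swap p)) u"
    using assms(2) by (auto simp: undirected_walk_iff pcas_reverse)
  then show ?thesis by (auto simp: linked_def)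
qed

text \<open>
  The set \<open>D\<close> of vertices is one side of a partition that only the edge \<open>e\<close> crosses, in either
  direction.  Such a set exists for every edge of a tree.
\<close>

definition cuts :: "('a \<times> 'a) set \<Rightarrow> 'a set \<Rightarrow> 'a \<times> 'a \<Rightarrow> bool" where
  "cuts E D e \<longleftrightarrow> e \<in> E \<and> (\<forall>(x, y) \<in> E. (x \<in> D \<longleftrightarrow> y \<notin> D) \<longleftrightarrow> (x, y) = e)"

lemma cutsD: "cuts E D e \<Longrightarrow> (x, y) \<in> E \<Longrightarrow> (x \<in> D \<longleftrightarrow> y \<notin> D) \<longleftrightarrow> (x, y) = e"
  by (auto simp: cuts_def)

lemma cutsI:
  "e \<in> E \<Longrightarrow> (\<And>x y. (x, y) \<in> E \<Longrightarrow> (x \<in> D \<longleftrightarrow> y \<notin> D) \<longleftrightarrow> (x, y) = e) \<Longrightarrow> cuts E D e"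
  by (auto simp: cuts_def)

lemma cuts_ends: "cuts E D (u, v) \<Longrightarrow> u \<in> D \<longleftrightarrow> v \<notin> D"
  by (auto simp: cuts_def)

lemma walk_avoiding_cut_stays:
  assumes "cuts E D e" "pcas u p v" "set p \<subseteq> E \<union> E\<inverse>" "e \<notin> set p" "prod.swap e \<notin> set p"
  shows "u \<in> D \<longleftrightarrow> v \<in> D"
  using assms(2-)
proof (induction p arbitrary: u)
  case (Cons a p)
  obtain x y where a: "a = (x, y)" by force
  have "x \<in> D \<longleftrightarrow> y \<in> D"
  proof (cases "(x, y) \<in> E")
    case True
    then show ?thesis using cutsD[OF assms(1) True] Cons.prems a by auto
  next
    case False
    then have "(y, x) \<in> E" using Cons.prems a by auto
    then show ?thesis using cutsD[OF assms(1)] Cons.prems a by fastforce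
  qed
  then show ?case using Cons a by auto
qed simp

text \<open>
  A walk changes sides exactly when it runs along \<open>e\<close>, so a path between different sides must use
  \<open>e\<close>.  A shortest path that uses \<open>e\<close> cannot return to the side it came from: its first and its last
  crossing would go in opposite directions, so the part between them would begin and end at the same
  vertex and could be left out.
\<close>

lemma shortest_path_meets_cut_iff:
  assumes cut: "cuts (parcs (tree_graph T)) D e" and p: "shortest_path T i p j"
  shows "e \<in> set p \<or> prod.swap e \<in> set p \<longleftrightarrow> (i \<in> D \<longleftrightarrow> j \<notin> D)"
proof
  let ?E = "parcs (tree_graph T)"
  have walk: "i \<in> pverts (tree_graph T)" "set p \<subseteq> ?E \<union> ?E\<inverse>" "pcas i p j"
    and least: "\<And>q. undirected_walk T i q j \<Longrightarrow> length p \<le> length q"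
    using p by (auto simp: shortest_path_def undirected_walk_iff simp flip: undirected_walk_def)
  show "e \<in> set p \<or> prod.swap e \<in> set p" if "i \<in> D \<longleftrightarrow> j \<notin> D"
    using walk_avoiding_cut_stays[OF cut walk(3,2)] that by argo
  define P where "P a \<longleftrightarrow> a = e \<or> a = prod.swap e" for a
  assume "e \<in> set p \<or> prod.swap e \<in> set p"
  then have "\<exists>a\<in>set p. P a" by (auto simp: P_def)
  then obtain p1 a p2 where p_eq: "p = p1 @ a # p2" and a: "P a" and p1: "\<forall>b\<in>set p1. \<not> P b"
    using split_list_first_prop[of p P] by metis
  obtain u v where e: "e = (u, v)" by force
  obtain x y where xy: "a = (x, y)" by force
  have sides: "u \<in> D \<longleftrightarrow> v \<notin> D" using cut unfolding e by (rule cuts_ends)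
  have p1_walk: "pcas i p1 x" and p2_walk: "pcas y p2 j"
    using walk(3) by (auto simp: p_eq xy pcas_append)
  have ix: "i \<in> D \<longleftrightarrow> x \<in> D"
    using walk_avoiding_cut_stays[OF cut p1_walk] p1 walk(2) by (auto simp: p_eq P_def)
  show "i \<in> D \<longleftrightarrow> j \<notin> D"
  proof (cases "\<exists>b\<in>set p2. P b")
    case False
    then have "y \<in> D \<longleftrightarrow> j \<in> D"
      using walk_avoiding_cut_stays[OF cut p2_walk] walk(2) by (auto simp: p_eq P_def)
    then show ?thesis using ix a sides by (auto simp: P_def e xy)
  next
    case True
    then obtain q b p3 where p2_eq: "p2 = q @ b # p3" and b: "P b" and p3: "\<forall>c\<in>set p3. \<not> P c"
      using split_list_last_prop[of p2 P] by metis
    obtain x' y' where xy': "b = (x', y')" by force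
    have p3_walk: "pcas y' p3 j"
      using p2_walk by (auto simp: p2_eq xy' pcas_append)
    have y'j: "y' \<in> D \<longleftrightarrow> j \<in> D"
      using walk_avoiding_cut_stays[OF cut p3_walk] p3 walk(2) by (auto simp: p_eq p2_eq P_def)
    show ?thesis
    proof (rule ccontr)
      \<comment> \<open>Two crossings that return to the starting side enclose a detour that can \<beta> skipped.\<close>
      assume "\<not> ?thesis"
      then have "x = y'" using ix y'j a b sides by (auto simp: P_def e xy xy')
      then have "undirected_walk T i (p1 @ p3) j"
        using walk p1_walk p3_walk by (auto simp: undirected_walk_iff pcas_append p_eq p2_eq)
      then show False using least by (fastforce simp: p_eq p2_eq)
    qed
  qed
qed

lemma shortest_path_exists:
  assumes "linked T i j" shows "\<exists>p. shortest_path T i p j"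
proof -
  obtain p where "undirected_walk T i p j"
    and "\<And>q. undirected_walk T i q j \<Longrightarrow> length p \<le> length q"
    using assms ex_has_least_nat[of "\<lambda>p. undirected_walk T i p j" _ length]
    by (auto simp: linked_def)
  then show ?thesis by (auto simp: shortest_path_def simp flip: undirected_walk_def)
qed

text \<open>
  This describes the entries of \<open>B_mat\<close> without paths, and is the form in which the matrices of
  different trees are compared.
\<close>

lemma B_mat_cut:
  assumes "cuts (parcs (tree_graph T)) D e" "linked T i j" "i \<noteq> j"
  shows "B_mat T e {i, j} = (if i \<in> D \<longleftrightarrow> j \<notin> D then 1 else 0)"
proof -
  obtain p where p: "shortest_path T i p j" using shortest_path_exists[OF assms(2)] by auto
  have "(\<exists>i' j' p. {i, j} = {i', j'} \<and> i' \<noteq> j' \<and> shortest_path T i' p j' \<and>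
      (e \<in> set p \<or> prod.swap e \<in> set p)) \<longleftrightarrow> (i \<in> D \<longleftrightarrow> j \<notin> D)"
    (is "?L \<longleftrightarrow> ?R")
  proof
    assume ?L
    then obtain i' j' q where q: "{i, j} = {i', j'}" "shortest_path T i' q j'"
      "e \<in> set q \<or> prod.swap e \<in> set q" by blast
    then have "i' \<in> D \<longleftrightarrow> j' \<notin> D" using shortest_path_meets_cut_iff[OF assms(1) q(2)] by simp
    then show ?R using q(1) unfolding doubleton_eq_iff by metis
  next
    assume ?R
    then have "e \<in> set p \<or> prod.swap e \<in> set p"
      using shortest_path_meets_cut_iff[OF assms(1) p] by simp
    then show ?L using p assms(3) by (intro exI[of _ i] exI[of _ j] exI[of _ p]) simp
  qed
  then show ?thesis by (simp add: B_mat_def)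
qed

section \<open>Rooted trees\<close>

definition connected_tree :: "'a rtree \<Rightarrow> bool" where
  "connected_tree T \<longleftrightarrow> (\<forall>u \<in> pverts (tree_graph T). \<forall>v \<in> pverts (tree_graph T). linked T u v)"

lemma rooted_treeD:
  assumes "rooted_tree T"
  shows "finite (parcs (tree_graph T))" "finite (pverts (tree_graph T))"
    "\<And>x y. (x, y) \<in> parcs (tree_graph T) \<Longrightarrow> x \<in> pverts (tree_graph T) \<and> y \<in> pverts (tree_graph T)"
    "tree_root T \<in> Lv T" "tree_root T \<in> pverts (tree_graph T)"
    "\<And>v. v \<in> pverts (tree_graph T) \<Longrightarrow>
      \<exists>!p. set p \<subseteq> parcs (tree_graph T) \<and> pcas (tree_root T) p v"
proof -
  have root: "tree_root T \<in> Lv T" using assms by (simp add: rooted_tree_def)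
  then show "tree_root T \<in> Lv T" "tree_root T \<in> pverts (tree_graph T)" by (auto simp: Lv_def)
  then show "\<exists>!p. set p \<subseteq> parcs (tree_graph T) \<and> pcas (tree_root T) p v"
    if "v \<in> pverts (tree_graph T)" for v
    using assms that unfolding rooted_tree_def awalk_with_proj by simp
  interpret pair_fin_digraph "tree_graph T" using assms by (simp add: rooted_tree_def)
  show "finite (parcs (tree_graph T))" "finite (pverts (tree_graph T))"
    by (rule pair_finite_arcs, rule pair_finite_verts)
  show "x \<in> pverts (tree_graph T) \<and> y \<in> pverts (tree_graph T)"
    if "(x, y) \<in> parcs (tree_graph T)" for x y
    using wellformed'[OF that] by simp
qed

lemma rooted_tree_linked_root:
  assumes "rooted_tree T" "v \<in> pverts (tree_graph T)"
  shows "linked T (tree_root T) v"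
proof -
  obtain p where "set p \<subseteq> parcs (tree_graph T)" "pcas (tree_root T) p v"
    using rooted_treeD(6)[OF assms] by (elim ex1E conjE)
  then have "undirected_walk T (tree_root T) p v"
    unfolding undirected_walk_iff using rooted_treeD(5)[OF assms(1)] by blast
  then show ?thesis unfolding linked_def by blast
qed

lemma connected_treeI:
  assumes "\<And>v. v \<in> pverts (tree_graph T) \<Longrightarrow> linked T r v" "r \<in> pverts (tree_graph T)"
  shows "connected_tree T"
  unfolding connected_tree_def
proof (intro ballI)
  fix u v assume u: "u \<in> pverts (tree_graph T)" and v: "v \<in> pverts (tree_graph T)"
  show "linked T u v" by (rule linked_trans[OF linked_sym[OF assms(1)[OF u] u] assms(1)[OF v]])
qed

lemma rooted_tree_connected: "rooted_tree T \<Longrightarrow> connected_tree T"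
  by (rule connected_treeI[OF rooted_tree_linked_root rooted_treeD(5)])

text \<open>
  The vertices whose walk from the root passes through \<open>e\<close>, that is, the descendants of the head
  of \<open>e\<close>, form one side.  The walk to the head of an arc extends the walk to its tail by that arc,
  so only the arc \<open>e\<close> can lead into this set.
\<close>

lemma rooted_tree_cut:
  assumes T: "rooted_tree T" and e: "e \<in> parcs (tree_graph T)"
  shows "\<exists>D. cuts (parcs (tree_graph T)) D e"
proof -
  let ?E = "parcs (tree_graph T)" and ?r = "tree_root T"
  note T = rooted_treeD[OF T]
  define path where "path v = (THE p. set p \<subseteq> ?E \<and> pcas ?r p v)" for v
  have path: "set (path v) \<subseteq> ?E" "pcas ?r (path v) v" if "v \<in> pverts (tree_graph T)" for v
    using theI'[OF T(6)[OF that]] by (auto simp: path_def)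
  have path_unique: "path v = p"
    if "v \<in> pverts (tree_graph T)" "set p \<subseteq> ?E" "pcas ?r p v" for v p
    using the1_equality[OF T(6)[OF that(1)]] that by (auto simp: path_def)
  have path_arc: "path y = path x @ [(x, y)]" if "(x, y) \<in> ?E" for x y
    using that T(3)[OF that] path by (intro path_unique) (auto simp: pcas_append)
  \<comment> \<open>Otherwise the part of \<open>path u\<close> before \<open>e\<close> would be a second walk from the root to \<open>u\<close>.\<close>
  have first: "e \<notin> set (path u)" if "e = (u, v)" for u v
  proof
    assume "e \<in> set (path u)"
    then obtain p q where pq: "path u = p @ e # q" by (auto simp: in_set_conv_decomp)
    have u: "u \<in> pverts (tree_graph T)" using T(3) e that by auto
    have "path u = p" using path[OF u] by (intro path_unique) (auto simp: pq that u pcas_append)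
    then show False using pq by simp
  qed
  have "cuts ?E {w. e \<in> set (path w)} e"
    unfolding cuts_def using e first path_arc by fastforce
  then show ?thesis by blast
qed

lemma rooted_tree_no_loop:
  assumes "rooted_tree T"
  shows "(x, x) \<notin> parcs (tree_graph T)"
proof
  assume "(x, x) \<in> parcs (tree_graph T)"
  from rooted_tree_cut[OF assms this] obtain D where "cuts (parcs (tree_graph T)) D (x, x)" ..
  from cuts_ends[OF this] show False by simp
qed

lemma vert_degree_eq:
  "vert_degree T v = card {e \<in> parcs (tree_graph T). snd e = v} +
     card {e \<in> parcs (tree_graph T). fst e = v}"
  by (simp add: vert_degree_def in_degree_def out_degree_def in_arcs_def out_arcs_def)

lemma vert_degree_cong:
  assumes "\<And>e. fst e = v \<or> snd e = v \<Longrightarrow>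
    e \<in> parcs (tree_graph T) \<longleftrightarrow> e \<in> parcs (tree_graph S)"
  shows "vert_degree T v = vert_degree S v"
proof -
  have "{e \<in> parcs (tree_graph T). snd e = v} = {e \<in> parcs (tree_graph S). snd e = v}"
    "{e \<in> parcs (tree_graph T). fst e = v} = {e \<in> parcs (tree_graph S). fst e = v}"
    using assms by auto
  then show ?thesis by (simp add: vert_degree_eq)
qed

lemma card_add_card_eq_1:
  assumes "finite I" "finite J" "card I + card J = 1"
  shows "\<exists>e. I \<union> J = {e} \<and> I \<inter> J = {}"
proof -
  have "I = {} \<or> J = {}" using assms card_gt_0_iff[of I] card_gt_0_iff[of J] by linarith
  then have "card (I \<union> J) = 1" "I \<inter> J = {}" using assms(3) by auto
  then show ?thesis by (metis card_1_singletonE)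
qed

lemma leaf_arc:
  assumes "finite (parcs (tree_graph T))" "v \<in> Lv T"
  shows "\<exists>e\<in>parcs (tree_graph T). fst e \<noteq> snd e \<and>
    (\<forall>a\<in>parcs (tree_graph T). fst a = v \<or> snd a = v \<longleftrightarrow> a = e)"
proof -
  let ?I = "{e \<in> parcs (tree_graph T). snd e = v}" and ?O = "{e \<in> parcs (tree_graph T). fst e = v}"
  have fin: "finite ?I" "finite ?O" by (rule finite_subset[OF _ assms(1)], blast)+
  have "vert_degree T v = 1" using assms(2) by (simp add: Lv_def)
  then obtain e where "?I \<union> ?O = {e}" "?I \<inter> ?O = {}"
    using card_add_card_eq_1[OF fin] unfolding vert_degree_eq by blast
  then have mem: "a \<in> ?I \<union> ?O \<longleftrightarrow> a = e" and not_both: "a \<notin> ?I \<inter> ?O" for a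
    by (simp_all only: singleton_iff empty_iff not_False_eq_True)
  show ?thesis
  proof (intro bexI[of _ e] conjI ballI)
    show "e \<in> parcs (tree_graph T)" using mem[of e] by blast
    show "fst e \<noteq> snd e" using mem[of e] not_both[of e] by auto
    show "fst a = v \<or> snd a = v \<longleftrightarrow> a = e" if "a \<in> parcs (tree_graph T)" for a
      using mem[of a] that by auto
  qed
qed

lemma leaf_cut:
  assumes "finite (parcs (tree_graph T))" "v \<in> Lv T"
  shows "\<exists>e. cuts (parcs (tree_graph T)) {v} e"
proof -
  obtain e where e: "e \<in> parcs (tree_graph T)" "fst e \<noteq> snd e"
    "\<And>a. a \<in> parcs (tree_graph T) \<Longrightarrow> fst a = v \<or> snd a = v \<longleftrightarrow> a = e"
    using leaf_arc[OF assms] by blast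
  have "cuts (parcs (tree_graph T)) {v} e"
  proof (rule cutsI)
    fix x y assume xy: "(x, y) \<in> parcs (tree_graph T)"
    show "(x \<in> {v} \<longleftrightarrow> y \<notin> {v}) \<longleftrightarrow> (x, y) = e"
      using e(2) e(3)[OF xy] by auto
  qed (rule e(1))
  then show ?thesis by blast
qed

lemma in_arc_exists:
  assumes T: "rooted_tree T" "v \<in> pverts (tree_graph T)" "v \<noteq> tree_root T"
  shows "\<exists>u. (u, v) \<in> parcs (tree_graph T)"
proof -
  obtain p where p: "set p \<subseteq> parcs (tree_graph T)" "pcas (tree_root T) p v"
    using rooted_treeD(6)[OF T(1,2)] by auto
  then have "p \<noteq> []" using T(3) by auto
  then obtain q a where "p = q @ [a]" by (metis rev_exhaust)
  then show ?thesis using p by (cases a) (auto simp: pcas_append)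
qed

text \<open>
  The tail of an arc is the root or has an incoming arc as well, and then it is not a leaf.  So
  every arc leaves \<open>h\<close> or \<open>l\<close>, the arc into \<open>l\<close> comes from \<open>h\<close>, and it is the only arc at the leaf
  \<open>h\<close>.
\<close>

lemma star_tree_arcs:
  assumes "star_tree m h l S"
  shows "(h, l) \<in> parcs (tree_graph S)" "h \<in> Lv S" "l \<notin> Lv S" "l \<in> pverts (tree_graph S)"
    "pverts (tree_graph S) = insert l (Lv S)"
    "\<And>x y. (x, y) \<in> parcs (tree_graph S) \<Longrightarrow> (x, y) = (h, l) \<or> x = l \<and> y \<in> Lv S - {h}"
proof -
  have S: "rooted_tree S" and root: "tree_root S = h" and inner: "pverts (tree_graph S) - Lv S = {l}"
    using assms by (auto simp: star_tree_def)
  note SD = rooted_treeD[OF S]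
  show h: "h \<in> Lv S" using SD(4) root by simp
  show l: "l \<notin> Lv S" "l \<in> pverts (tree_graph S)" using inner by auto
  show pv: "pverts (tree_graph S) = insert l (Lv S)" using inner by (auto simp: Lv_def)
  have leaf1: "a = b" if "v \<in> Lv S" "a \<in> parcs (tree_graph S)" "b \<in> parcs (tree_graph S)"
    "fst a = v \<or> snd a = v" "fst b = v \<or> snd b = v" for v a b
  proof -
    obtain e where "\<forall>a\<in>parcs (tree_graph S). fst a = v \<or> snd a = v \<longleftrightarrow> a = e"
      using leaf_arc[OF SD(1) \<open>v \<in> Lv S\<close>] by blast
    then have "a = e" "b = e" using that by simp_all
    then show "a = b" by simp
  qed
  have tail: "x = h \<or> x = l" if xy: "(x, y) \<in> parcs (tree_graph S)" for x y
  proof (rule ccontr)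
    assume neg: "\<not> ?thesis"
    then have x: "x \<in> Lv S" using SD(3)[OF xy] pv by auto
    obtain u where ux: "(u, x) \<in> parcs (tree_graph S)"
      using in_arc_exists[OF S] SD(3)[OF xy] neg root by auto
    have "(x, y) = (u, x)" using leaf1[OF x xy ux] by simp
    then show False using xy rooted_tree_no_loop[OF S] by auto
  qed
  obtain u where "(u, l) \<in> parcs (tree_graph S)"
    using in_arc_exists[OF S l(2)] l(1) h unfolding root by blast
  then show hl: "(h, l) \<in> parcs (tree_graph S)" using tail rooted_tree_no_loop[OF S] by blast
  show "(x, y) = (h, l) \<or> x = l \<and> y \<in> Lv S - {h}" if xy: "(x, y) \<in> parcs (tree_graph S)" for x y
  proof (cases "x = h \<or> y = h")
    case True
    then show ?thesis using leaf1[OF h xy hl] unfolding fst_conv snd_conv by blast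
  next
    case False
    then have "x = l" using tail[OF xy] by simp
    moreover have "y \<noteq> l" using rooted_tree_no_loop[OF S] xy \<open>x = l\<close> by blast
    moreover have "y \<in> insert l (Lv S)" using SD(3)[OF xy] unfolding pv by (rule conjunct2)
    ultimately show ?thesis using False by simp
  qed
qed

section \<open>Gluing a star to a leaf\<close>

locale glued_star =
  fixes T T' S :: "'a rtree" and h l :: 'a and m :: nat
  assumes T': "rooted_tree T'"
    and l_leaf: "l \<in> Lv T'"
    and hl: "(h, l) \<in> parcs (tree_graph T')"
    and star: "star_tree m h l S"
    and shared: "pverts (tree_graph T') \<inter> pverts (tree_graph S) = {h, l}"
    and T_def: "T = glue T' S"
begin

lemma S: "rooted_tree S" "tree_root S = h"
  using star by (auto simp: star_tree_def)

lemmas T'D = rooted_treeD[OF T'] and SD = rooted_treeD[OF S(1)] and starD = star_tree_arcs[OF star]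

lemma T_simps:
  "parcs (tree_graph T) = parcs (tree_graph T') \<union> parcs (tree_graph S)"
  "pverts (tree_graph T) = pverts (tree_graph T') \<union> pverts (tree_graph S)"
  by (simp_all add: T_def glue_def)

lemma h_ne_l: "h \<noteq> l"
  using starD(2,3) by blast

lemma finite_arcs: "finite (parcs (tree_graph T))"
  using T'D(1) SD(1) by (simp add: T_simps)

lemma arc_at_l: "a \<in> parcs (tree_graph T') \<Longrightarrow> fst a = l \<or> snd a = l \<longleftrightarrow> a = (h, l)"
proof -
  assume a: "a \<in> parcs (tree_graph T')"
  obtain e where e: "\<forall>a\<in>parcs (tree_graph T'). fst a = l \<or> snd a = l \<longleftrightarrow> a = e"
    using leaf_arc[OF T'D(1) l_leaf] by blast
  have "(h, l) = e" using bspec[OF e hl] by simp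
  then show ?thesis using bspec[OF e a] by simp
qed

lemma arc_at_h: "a \<in> parcs (tree_graph S) \<Longrightarrow> fst a = h \<or> snd a = h \<longleftrightarrow> a = (h, l)"
  using starD(6)[of "fst a" "snd a"] h_ne_l by (cases a) auto

text \<open>
  The trees share the edge \<open>(h, l)\<close>, which is the only edge of \<open>T'\<close> at \<open>l\<close> and the only edge of \<open>S\<close>
  at \<open>h\<close>.  Hence a vertex of \<open>T'\<close> other than \<open>l\<close> keeps its degree in the glued tree, and so does a
  vertex of \<open>S\<close> other than \<open>h\<close>.
\<close>

lemma glue_leaves: "Lv T = (Lv T' - {l}) \<union> (Lv S - {h})"
proof -
  have deg_T': "vert_degree T v = vert_degree T' v"
    if "v \<in> pverts (tree_graph T')" "v \<noteq> l" for v
  proof (rule vert_degree_cong)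
    fix a assume a: "fst a = v \<or> snd a = v"
    have "a \<in> parcs (tree_graph T')" if "a \<in> parcs (tree_graph S)"
    proof -
      have "v \<in> pverts (tree_graph S)" using SD(3)[of "fst a" "snd a"] that a by auto
      then have "v = h" using shared \<open>v \<in> pverts (tree_graph T')\<close> \<open>v \<noteq> l\<close> by auto
      then show ?thesis using arc_at_h[OF that] a hl by auto
    qed
    then show "a \<in> parcs (tree_graph T) \<longleftrightarrow> a \<in> parcs (tree_graph T')" by (auto simp: T_simps)
  qed
  have deg_S: "vert_degree T v = vert_degree S v"
    if "v \<in> pverts (tree_graph S)" "v \<noteq> h" for v
  proof (rule vert_degree_cong)
    fix a assume a: "fst a = v \<or> snd a = v"
    have "a \<in> parcs (tree_graph S)" if "a \<in> parcs (tree_graph T')"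
    proof -
      have "v \<in> pverts (tree_graph T')" using T'D(3)[of "fst a" "snd a"] that a by auto
      then have "v = l" using shared \<open>v \<in> pverts (tree_graph S)\<close> \<open>v \<noteq> h\<close> by auto
      then show ?thesis using arc_at_l[OF that] a starD(1) by auto
    qed
    then show "a \<in> parcs (tree_graph T) \<longleftrightarrow> a \<in> parcs (tree_graph S)" by (auto simp: T_simps)
  qed
  have "v \<in> Lv T \<longleftrightarrow> v \<in> (Lv T' - {l}) \<union> (Lv S - {h})" for v
  proof (cases "v \<in> pverts (tree_graph T') \<and> v \<noteq> l")
    case True
    then have "v \<in> Lv S - {h} \<Longrightarrow> False" using shared by (auto simp: Lv_def)
    then show ?thesis using True deg_T' by (auto simp: Lv_def T_simps)
  next
    case False
    then have ne: "v \<in> pverts (tree_graph T) \<Longrightarrow> v \<in> pverts (tree_graph S) \<and> v \<noteq> h"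
      using h_ne_l starD(4) shared by (auto simp: T_simps)
    have "v \<notin> Lv T' - {l}" using False by (auto simp: Lv_def)
    moreover have "v \<in> Lv T \<longleftrightarrow> v \<in> Lv S - {h}"
      using ne deg_S by (auto simp: Lv_def T_simps)
    ultimately show ?thesis by auto
  qed
  then show ?thesis by auto
qed

lemma connected: "connected_tree T"
proof (rule connected_treeI)
  have mono: "linked T' u v \<Longrightarrow> linked T u v" "linked S u v \<Longrightarrow> linked T u v" for u v
    unfolding linked_def undirected_walk_iff T_simps by blast+
  have left: "linked T (tree_root T') v" if "v \<in> pverts (tree_graph T')" for v
    by (rule mono(1)[OF rooted_tree_linked_root[OF T' that]])
  have right: "linked T h v" if "v \<in> pverts (tree_graph S)" for v
    using mono(2)[OF rooted_tree_linked_root[OF S(1) that]] by (simp add: S(2))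
  have "h \<in> pverts (tree_graph T')" using shared by auto
  then show "linked T (tree_root T') v" if "v \<in> pverts (tree_graph T)" for v
    using that left linked_trans[OF left right] by (auto simp: T_simps)
  show "tree_root T' \<in> pverts (tree_graph T)" using T'D(5) by (simp add: T_simps)
qed

section \<open>Entries of the three matrices\<close>

text \<open>
  The glued tree retracts onto each of its two parts: the leaves of \<open>S\<close> except \<open>h\<close> are moved to \<open>l\<close>, or
  the vertices of \<open>T'\<close> other than \<open>l\<close> are moved to \<open>h\<close>.
\<close>

definition retract_T' :: "'a \<Rightarrow> 'a" where "retract_T' x = (if x \<in> pverts (tree_graph T') then x else l)"

definition retract_S :: "'a \<Rightarrow> 'a" where "retract_S x = (if x \<in> pverts (tree_graph S) then x else h)"

lemma retract_T'_lower:
  assumes "v \<in> pverts (tree_graph S)" "v \<noteq> h"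
  shows "retract_T' v = l"
proof (cases "v \<in> pverts (tree_graph T')")
  case True
  then have "v \<in> {h, l}" using assms(1) unfolding shared[symmetric] by simp
  then show ?thesis using assms(2) by (simp add: retract_T'_def)
qed (simp add: retract_T'_def)

lemma retract_S_upper:
  assumes "v \<in> pverts (tree_graph T')" "v \<noteq> l"
  shows "retract_S v = h"
proof (cases "v \<in> pverts (tree_graph S)")
  case True
  then have "v \<in> {h, l}" using assms(1) unfolding shared[symmetric] by simp
  then show ?thesis using assms(2) by (simp add: retract_S_def)
qed (simp add: retract_S_def)

text \<open>
  The retraction fixes every arc of \<open>T'\<close> and shrinks every other arc to the vertex \<open>l\<close>, so the
  preimage of a side of \<open>e\<close> is crossed by no further arc.
\<close>

lemma cut_pullback_T':
  assumes "cuts (parcs (tree_graph T')) D e"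
  shows "cuts (parcs (tree_graph T)) (retract_T' -` D) e"
proof -
  have "(retract_T' x \<in> D \<longleftrightarrow> retract_T' y \<notin> D) \<longleftrightarrow> (x, y) = e" if xy: "(x, y) \<in> parcs (tree_graph T)" for x y
  proof (cases "(x, y) \<in> parcs (tree_graph T')")
    case True
    then show ?thesis using cutsD[OF assms True] T'D(3)[OF True] by (simp add: retract_T'_def)
  next
    case False
    then have "x = l" "y \<in> Lv S - {h}" using xy starD(6)[of x y] hl by (auto simp: T_simps)
    then have "retract_T' x = l" "retract_T' y = l"
      using retract_T'_lower starD(4) h_ne_l by (auto simp: Lv_def)
    then have "retract_T' x = retract_T' y" by simp
    moreover have "(x, y) \<noteq> e" using False assms by (auto simp: cuts_def)
    ultimately show ?thesis by simp
  qed
  then show ?thesis using assms by (auto simp: cuts_def T_simps)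
qed

text \<open>
  The retraction fixes every arc of \<open>S\<close> and shrinks every other arc to the vertex \<open>h\<close>.
\<close>

lemma cut_pullback_S:
  assumes "cuts (parcs (tree_graph S)) D e"
  shows "cuts (parcs (tree_graph T)) (retract_S -` D) e"
proof -
  have "(retract_S x \<in> D \<longleftrightarrow> retract_S y \<notin> D) \<longleftrightarrow> (x, y) = e" if xy: "(x, y) \<in> parcs (tree_graph T)" for x y
  proof (cases "(x, y) \<in> parcs (tree_graph S)")
    case True
    then show ?thesis using cutsD[OF assms True] SD(3)[OF True] by (simp add: retract_S_def)
  next
    case False
    then have xy': "(x, y) \<in> parcs (tree_graph T')" using xy by (auto simp: T_simps)
    moreover have "(x, y) \<noteq> (h, l)" using False starD(1) by auto
    ultimately have "x \<noteq> l" "y \<noteq> l" using arc_at_l[OF xy'] by auto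
    then have "retract_S x = retract_S y"
      using T'D(3)[OF xy'] retract_S_upper by simp
    moreover have "(x, y) \<noteq> e" using False assms by (auto simp: cuts_def)
    ultimately show ?thesis by simp
  qed
  then show ?thesis using assms by (auto simp: cuts_def T_simps)
qed

lemma retract_in: "retract_T' x \<in> pverts (tree_graph T')" "retract_S x \<in> pverts (tree_graph S)"
  using l_leaf starD(2) by (auto simp: retract_T'_def retract_S_def Lv_def)

text \<open>
  The value \<open>0\<close> for pairs that are moved to a single vertex is the entry of the column \<open>\<star>\<close> in
  the row of an edge.
\<close>

lemma B_mat_contract_T':
  assumes "e \<in> parcs (tree_graph T')" "i \<in> pverts (tree_graph T)" "j \<in> pverts (tree_graph T)" "i \<noteq> j"
  shows "B_mat T e {i, j} = (if retract_T' i = retract_T' j then 0 else B_mat T' e {retract_T' i, retract_T' j})"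
proof -
  obtain D where D: "cuts (parcs (tree_graph T')) D e" using rooted_tree_cut[OF T' assms(1)] ..
  have "linked T i j" "linked T' (retract_T' i) (retract_T' j)"
    using connected rooted_tree_connected[OF T'] assms retract_in by (auto simp: connected_tree_def)
  note linked = this
  have glue_entry: "B_mat T e {i, j} = (if retract_T' i \<in> D \<longleftrightarrow> retract_T' j \<notin> D then 1 else 0)"
    using B_mat_cut[OF cut_pullback_T'[OF D] linked(1) assms(4)] by (simp only: vimage_eq)
  show ?thesis
  proof (cases "retract_T' i = retract_T' j")
    case True
    then show ?thesis unfolding glue_entry by simp
  next
    case False
    then show ?thesis unfolding glue_entry B_mat_cut[OF D linked(2) False] by (simp only: if_False)
  qed
qed

lemma B_mat_contract_S:
  assumes "e \<in> parcs (tree_graph S)" "i \<in> pverts (tree_graph T)" "j \<in> pverts (tree_graph T)" "i \<noteq> j"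
  shows "B_mat T e {i, j} = (if retract_S i = retract_S j then 0 else B_mat S e {retract_S i, retract_S j})"
proof -
  obtain D where D: "cuts (parcs (tree_graph S)) D e" using rooted_tree_cut[OF S(1) assms(1)] ..
  have "linked T i j" "linked S (retract_S i) (retract_S j)"
    using connected rooted_tree_connected[OF S(1)] assms retract_in by (auto simp: connected_tree_def)
  note linked = this
  have glue_entry: "B_mat T e {i, j} = (if retract_S i \<in> D \<longleftrightarrow> retract_S j \<notin> D then 1 else 0)"
    using B_mat_cut[OF cut_pullback_S[OF D] linked(1) assms(4)] by (simp only: vimage_eq)
  show ?thesis
  proof (cases "retract_S i = retract_S j")
    case True
    then show ?thesis unfolding glue_entry by simp
  next
    case False
    then show ?thesis unfolding glue_entry B_mat_cut[OF D linked(2) False] by (simp only: if_False)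
  qed
qed

text \<open>
  The variable \<open>p\<^sub>c\<close> is sent to the tensor product of the variables with subscripts \<open>col_T' c\<close> and
  \<open>col_S c\<close>.  Apart from the pairs that a retraction moves to one vertex and that become \<open>\<star>\<close>, these
  subscripts are the images of \<open>c\<close> under the two retractions.
\<close>

definition col_T' :: "'a set \<Rightarrow> 'a set option" where
  "col_T' c = (if c \<subseteq> Lv T' - {l} then Some c else if c \<subseteq> Lv S - {h} then None
     else Some {THE i. i \<in> c \<inter> (Lv T' - {l}), l})"

definition col_S :: "'a set \<Rightarrow> 'a set option" where
  "col_S c = (if c \<subseteq> Lv T' - {l} then None else if c \<subseteq> Lv S - {h} then Some c
     else Some {h, THE j. j \<in> c \<inter> (Lv S - {h})})"

lemma leaf_pair_cases:
  assumes "c \<in> upairs (Lv T)"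
  obtains (left) i j where "c = {i, j}" "i \<noteq> j" "i \<in> Lv T' - {l}" "j \<in> Lv T' - {l}"
      "col_T' c = Some {i, j}" "col_S c = None"
  | (right) i j where "c = {i, j}" "i \<noteq> j" "i \<in> Lv S - {h}" "j \<in> Lv S - {h}"
      "col_T' c = None" "col_S c = Some {i, j}"
  | (mixed) i j where "c = {i, j}" "i \<noteq> j" "i \<in> Lv T' - {l}" "j \<in> Lv S - {h}"
      "col_T' c = Some {i, l}" "col_S c = Some {h, j}"
proof -
  let ?L1 = "Lv T' - {l}" and ?L2 = "Lv S - {h}"
  have disj: "?L1 \<inter> ?L2 = {}" using shared starD(3) by (auto simp: Lv_def)
  have left_col: "col_T' {i, j} = Some {i, j} \<and> col_S {i, j} = None"
    if "i \<in> ?L1" "j \<in> ?L1" for i j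
  proof -
    have "{i, j} \<subseteq> ?L1" using that by blast
    then show ?thesis unfolding col_T'_def col_S_def by (simp only: if_True simp_thms)
  qed
  have right_col: "col_T' {i, j} = None \<and> col_S {i, j} = Some {i, j}"
    if "i \<in> ?L2" "j \<in> ?L2" for i j
  proof -
    have "{i, j} \<subseteq> ?L2" "\<not> {i, j} \<subseteq> ?L1" using that disj by blast+
    then show ?thesis unfolding col_T'_def col_S_def by (simp only: if_True if_False simp_thms)
  qed
  have mixed_col: "col_T' {i, j} = Some {i, l} \<and> col_S {i, j} = Some {h, j}"
    if "i \<in> ?L1" "j \<in> ?L2" for i j
  proof -
    have "(THE i'. i' \<in> {i, j} \<inter> ?L1) = i" "(THE j'. j' \<in> {i, j} \<inter> ?L2) = j"
      by (rule the_equality; use that disj in blast)+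
    moreover have "\<not> {i, j} \<subseteq> ?L1" "\<not> {i, j} \<subseteq> ?L2" using that disj by blast+
    ultimately show ?thesis unfolding col_T'_def col_S_def by (simp only: if_False simp_thms)
  qed
  obtain i j where c: "c = {i, j}" "i \<noteq> j" "i \<in> ?L1 \<union> ?L2" "j \<in> ?L1 \<union> ?L2"
    using assms unfolding glue_leaves upairs_def by blast
  have swap: "c = {j, i}" using c(1) by blast
  consider "i \<in> ?L1" "j \<in> ?L1" | "i \<in> ?L2" "j \<in> ?L2" | "i \<in> ?L1" "j \<in> ?L2" | "i \<in> ?L2" "j \<in> ?L1"
    using c(3,4) by blast
  then show thesis
  proof cases
    case 1
    have "col_T' c = Some {i, j}" "col_S c = None" unfolding c(1) using left_col[OF 1] by simp_all
    then show ?thesis by (rule left[OF c(1,2) 1])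
  next
    case 2
    have "col_T' c = None" "col_S c = Some {i, j}" unfolding c(1) using right_col[OF 2] by simp_all
    then show ?thesis by (rule right[OF c(1,2) 2])
  next
    case 3
    have "col_T' c = Some {i, l}" "col_S c = Some {h, j}"
      unfolding c(1) using mixed_col[OF 3] by simp_all
    then show ?thesis by (rule mixed[OF c(1,2) 3])
  next
    case 4
    have "col_T' c = Some {j, l}" "col_S c = Some {h, i}"
      unfolding swap using mixed_col[OF 4(2,1)] by simp_all
    then show ?thesis by (rule mixed[OF swap not_sym[OF c(2)] 4(2,1)])
  qed
qed

lemma retract_T'_leaf:
  "i \<in> Lv T' - {l} \<Longrightarrow> retract_T' i = i" "j \<in> Lv S - {h} \<Longrightarrow> retract_T' j = l"
  using retract_T'_lower by (simp_all add: retract_T'_def Lv_def)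

lemma retract_S_leaf:
  "i \<in> Lv T' - {l} \<Longrightarrow> retract_S i = h" "j \<in> Lv S - {h} \<Longrightarrow> retract_S j = j"
  using retract_S_upper by (simp_all add: retract_S_def Lv_def)

lemma leaf_in_glue:
  "i \<in> Lv T' - {l} \<Longrightarrow> i \<in> pverts (tree_graph T)" "j \<in> Lv S - {h} \<Longrightarrow> j \<in> pverts (tree_graph T)"
  by (auto simp: T_simps Lv_def)

lemma B_mat_star_col_T':
  assumes e: "e \<in> parcs (tree_graph T')" and c: "c \<in> upairs (Lv T)"
  shows "B_mat_star T' (Some e) (col_T' c) = B_mat T e c"
  using c
proof (cases rule: leaf_pair_cases)
  case left: (left i j)
  have "B_mat T e c = B_mat T' e {i, j}"
    unfolding left(1)
    using B_mat_contract_T'[OF e leaf_in_glue(1)[OF left(3)] leaf_in_glue(1)[OF left(4)] left(2)] left(2)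
    by (simp only: retract_T'_leaf(1)[OF left(3)] retract_T'_leaf(1)[OF left(4)] if_True if_False simp_thms)
  then show ?thesis by (simp only: left(5,6) B_mat_star.simps)
next
  case right: (right i j)
  have "B_mat T e c = 0"
    unfolding right(1)
    using B_mat_contract_T'[OF e leaf_in_glue(2)[OF right(3)] leaf_in_glue(2)[OF right(4)] right(2)]
    by (simp only: retract_T'_leaf(2)[OF right(3)] retract_T'_leaf(2)[OF right(4)] if_True if_False simp_thms)
  then show ?thesis by (simp only: right(5,6) B_mat_star.simps)
next
  case mixed: (mixed i j)
  have ne: "i \<noteq> l" using mixed(3) by simp
  have "B_mat T e c = B_mat T' e {i, l}"
    unfolding mixed(1)
    using B_mat_contract_T'[OF e leaf_in_glue(1)[OF mixed(3)] leaf_in_glue(2)[OF mixed(4)] mixed(2)] ne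
    by (simp only: retract_T'_leaf(1)[OF mixed(3)] retract_T'_leaf(2)[OF mixed(4)] if_True if_False simp_thms)
  then show ?thesis by (simp only: mixed(5,6) B_mat_star.simps)
qed

lemma B_mat_star_col_S:
  assumes e: "e \<in> parcs (tree_graph S)" and c: "c \<in> upairs (Lv T)"
  shows "B_mat_star S (Some e) (col_S c) = B_mat T e c"
  using c
proof (cases rule: leaf_pair_cases)
  case left: (left i j)
  have "B_mat T e c = 0"
    unfolding left(1)
    using B_mat_contract_S[OF e leaf_in_glue(1)[OF left(3)] leaf_in_glue(1)[OF left(4)] left(2)]
    by (simp only: retract_S_leaf(1)[OF left(3)] retract_S_leaf(1)[OF left(4)] if_True if_False simp_thms)
  then show ?thesis by (simp only: left(5,6) B_mat_star.simps)
next
  case right: (right i j)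
  have "B_mat T e c = B_mat S e {i, j}"
    unfolding right(1)
    using B_mat_contract_S[OF e leaf_in_glue(2)[OF right(3)] leaf_in_glue(2)[OF right(4)] right(2)] right(2)
    by (simp only: retract_S_leaf(2)[OF right(3)] retract_S_leaf(2)[OF right(4)] if_True if_False simp_thms)
  then show ?thesis by (simp only: right(5,6) B_mat_star.simps)
next
  case mixed: (mixed i j)
  have ne: "h \<noteq> j" using mixed(4) by blast
  have "B_mat T e c = B_mat S e {h, j}"
    unfolding mixed(1)
    using B_mat_contract_S[OF e leaf_in_glue(1)[OF mixed(3)] leaf_in_glue(2)[OF mixed(4)] mixed(2)] ne
    by (simp only: retract_S_leaf(1)[OF mixed(3)] retract_S_leaf(2)[OF mixed(4)] if_True if_False simp_thms)
  then show ?thesis by (simp only: mixed(5,6) B_mat_star.simps)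
qed

lemma col_in_star_cols:
  assumes "c \<in> upairs (Lv T)"
  shows "col_T' c \<in> star_cols T'" "col_S c \<in> star_cols S"
proof -
  have "col_T' c \<in> star_cols T' \<and> col_S c \<in> star_cols S"
    using assms
  proof (cases rule: leaf_pair_cases)
    case (mixed i j)
    then show ?thesis using l_leaf starD(2) by (auto simp: star_cols_def upairs_def)
  qed (auto simp: star_cols_def upairs_def)
  then show "col_T' c \<in> star_cols T'" "col_S c \<in> star_cols S" by auto
qed

text \<open>
  The set \<open>{v}\<close> is one side of the edge at a leaf \<open>v\<close>.  So the row of that edge is the indicator of
  the pairs that contain \<open>v\<close>, and each pair contains two leaves.
\<close>

lemma leaf_rows_sum:
  obtains e where "\<And>v. v \<in> Lv T \<Longrightarrow> e v \<in> parcs (tree_graph T)"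
    "\<And>c. c \<in> upairs (Lv T) \<Longrightarrow> (\<Sum>v\<in>Lv T. B_mat T (e v) c) = 2"
proof -
  have "\<forall>v\<in>Lv T. \<exists>e. cuts (parcs (tree_graph T)) {v} e"
    using leaf_cut[OF finite_arcs] by blast
  then obtain e where e: "\<And>v. v \<in> Lv T \<Longrightarrow> cuts (parcs (tree_graph T)) {v} (e v)"
    by metis
  have fin: "finite (Lv T)"
    using T'D(2) SD(2) by (auto simp: Lv_def T_simps)
  show thesis
  proof (rule that[of e])
    fix c assume "c \<in> upairs (Lv T)"
    then obtain i j where c: "c = {i, j}" "i \<noteq> j" "i \<in> Lv T" "j \<in> Lv T" by (auto simp: upairs_def)
    have "linked T i j" using connected c by (auto simp: connected_tree_def Lv_def)
    then have "(\<Sum>v\<in>Lv T. B_mat T (e v) c) = (\<Sum>v\<in>Lv T. if v \<in> {i, j} then 1 else 0)"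
      using c by (intro sum.cong) (auto simp: B_mat_cut[OF e])
    also have "\<dots> = int (card (Lv T \<inter> {i, j}))" using fin by (simp add: sum.If_cases Int_def)
    also have "Lv T \<inter> {i, j} = {i, j}" using c by auto
    finally show "(\<Sum>v\<in>Lv T. B_mat T (e v) c) = 2" using c by simp
  qed (use e in \<open>auto simp: cuts_def\<close>)
qed

end

section \<open>The ideal of the glued tree\<close>

context glued_star
begin

text \<open>
  The rows of the edges of \<open>T'\<close> and \<open>S\<close> in the starred matrices are rows of the matrix of \<open>T\<close>.  The
  rows \<open>\<star>\<close> compare the total degrees of the two monomials.  These agree as soon as the rows of \<open>T\<close>
  do, because a sum of rows of \<open>T\<close> has all entries equal to \<open>2\<close>.
\<close>

lemma same_degree_iff:
  assumes p: "Poly_Mapping.keys p \<subseteq> upairs (Lv T)" and q: "Poly_Mapping.keys q \<subseteq> upairs (Lv T)"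
  shows "weight (column_exponent (parcs (tree_graph T)) (B_mat T)) p =
      weight (column_exponent (parcs (tree_graph T)) (B_mat T)) q \<longleftrightarrow>
    weight (\<lambda>c. column_exponent (star_rows T') (B_mat_star T') (col_T' c)) p =
      weight (\<lambda>c. column_exponent (star_rows T') (B_mat_star T') (col_T' c)) q \<and>
    weight (\<lambda>c. column_exponent (star_rows S) (B_mat_star S) (col_S c)) p =
      weight (\<lambda>c. column_exponent (star_rows S) (B_mat_star S) (col_S c)) q"
    (is "?T \<longleftrightarrow> ?T' \<and> ?S")
proof -
  let ?w = "\<lambda>A k. weight (A :: 'a set \<Rightarrow> int) k"
  have row_T': "?w (\<lambda>c. B_mat_star T' (Some e) (col_T' c)) k = ?w (B_mat T e) k"
    if "e \<in> parcs (tree_graph T')" "Poly_Mapping.keys k \<subseteq> upairs (Lv T)" for e k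
    using that B_mat_star_col_T' by (intro weight_cong) blast
  have row_S: "?w (\<lambda>c. B_mat_star S (Some e) (col_S c)) k = ?w (B_mat T e) k"
    if "e \<in> parcs (tree_graph S)" "Poly_Mapping.keys k \<subseteq> upairs (Lv T)" for e k
    using that B_mat_star_col_S by (intro weight_cong) blast
  have fin: "finite (star_rows T')" "finite (star_rows S)"
    using T'D(1) SD(1) by (simp_all add: star_rows_def)
  have T_iff: "?T \<longleftrightarrow> (\<forall>e\<in>parcs (tree_graph T). ?w (B_mat T e) p = ?w (B_mat T e) q)"
    using weight_column_exponent_eq_iff[OF finite_arcs, of "B_mat T" "\<lambda>c. c" p q] by simp
  have T'_iff: "?T' \<longleftrightarrow> ?w (\<lambda>c. 1) p = ?w (\<lambda>c. 1) q \<and>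
      (\<forall>e\<in>parcs (tree_graph T'). ?w (B_mat T e) p = ?w (B_mat T e) q)"
    unfolding weight_column_exponent_eq_iff[OF fin(1)]
    by (simp add: star_rows_def row_T' p q)
  have S_iff: "?S \<longleftrightarrow> ?w (\<lambda>c. 1) p = ?w (\<lambda>c. 1) q \<and>
      (\<forall>e\<in>parcs (tree_graph S). ?w (B_mat T e) p = ?w (B_mat T e) q)"
    unfolding weight_column_exponent_eq_iff[OF fin(2)]
    by (simp add: star_rows_def row_S p q)
  have total: "?w (\<lambda>c. 1) p = ?w (\<lambda>c. 1) q"
    if rows: "\<forall>e\<in>parcs (tree_graph T). ?w (B_mat T e) p = ?w (B_mat T e) q"
  proof -
    obtain e where e: "\<And>v. v \<in> Lv T \<Longrightarrow> e v \<in> parcs (tree_graph T)"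
      "\<And>c. c \<in> upairs (Lv T) \<Longrightarrow> (\<Sum>v\<in>Lv T. B_mat T (e v) c) = 2"
      using leaf_rows_sum by blast
    have twice: "2 * ?w (\<lambda>c. 1) k = (\<Sum>v\<in>Lv T. ?w (B_mat T (e v)) k)"
      if "Poly_Mapping.keys k \<subseteq> upairs (Lv T)" for k
    proof -
      have "2 * ?w (\<lambda>c. 1) k = ?w (\<lambda>c. 2) k" by (simp add: weight_def sum_distrib_left mult.commute)
      also have "\<dots> = ?w (\<lambda>c. \<Sum>v\<in>Lv T. B_mat T (e v) c) k"
        by (rule weight_cong) (use that e(2) in auto)
      also have "\<dots> = (\<Sum>v\<in>Lv T. ?w (B_mat T (e v)) k)" by (rule weight_sum)
      finally show ?thesis .
    qed
    have "2 * ?w (\<lambda>c. 1) p = 2 * ?w (\<lambda>c. 1) q"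
      unfolding twice[OF p] twice[OF q] using rows e(1) by (intro sum.cong) auto
    then show ?thesis by simp
  qed
  have rows: "(\<forall>e\<in>parcs (tree_graph T). ?w (B_mat T e) p = ?w (B_mat T e) q) \<longleftrightarrow>
      (\<forall>e\<in>parcs (tree_graph T'). ?w (B_mat T e) p = ?w (B_mat T e) q) \<and>
      (\<forall>e\<in>parcs (tree_graph S). ?w (B_mat T e) p = ?w (B_mat T e) q)"
    unfolding T_simps(1) by (rule ball_Un)
  have combine: "A \<longleftrightarrow> (t \<and> B) \<and> t \<and> C" if "A \<longleftrightarrow> B \<and> C" "A \<Longrightarrow> t" for A B C t
    using that by blast
  show ?thesis unfolding T_iff T'_iff S_iff by (rule combine[OF rows total])
qed

lemma tfp_var_eq:
  "tfp_var T' S h l I J c =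
     pure_tensor (quot_alg (poly_alg (star_cols T')) I) (quot_alg (poly_alg (star_cols S)) J)
       (I +>\<^bsub>poly_alg (star_cols T')\<^esub> poly_var (col_T' c)) (J +>\<^bsub>poly_alg (star_cols S)\<^esub> poly_var (col_S c))"
  unfolding tfp_var_def Let_def col_T'_def col_S_def
  by (cases "c \<subseteq> Lv T' - {l}"; cases "c \<subseteq> Lv S - {h}") (simp_all only: if_True if_False)

text \<open>
  Both ideals consist of the polynomials whose coefficients sum to zero over each set of monomials
  of equal degree, and the two notions of degree partition the monomials in the same way.
\<close>

lemma tree_ideal_eq_toric_fiber_product:
  "tree_ideal T = toric_fiber_product T' S h l (tree_ideal_star T') (tree_ideal_star S)"
proof -
  let ?P = "upairs (Lv T)"
  let ?d = "weight (column_exponent (parcs (tree_graph T)) (B_mat T))"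
  let ?g = "\<lambda>m. (weight (\<lambda>c. column_exponent (star_rows T') (B_mat_star T') (col_T' c)) m,
      weight (\<lambda>c. column_exponent (star_rows S) (B_mat_star S) (col_S c)) m)"
  have "toric_fiber_product T' S h l (tree_ideal_star T') (tree_ideal_star S) =
      {f \<in> carrier (poly_alg ?P). pushforward ?g f = 0}"
    unfolding toric_fiber_product_def Let_def T_def[symmetric] tree_ideal_star_def
    by (rule kernel_of_monomial_tensors) (use col_in_star_cols tfp_var_eq in blast)+
  moreover have "tree_ideal T = {f \<in> carrier (poly_alg ?P). pushforward ?d f = 0}"
    unfolding tree_ideal_def toric_ideal_eq ..
  moreover have "pushforward ?d f = 0 \<longleftrightarrow> pushforward ?g f = 0" if "f \<in> carrier (poly_alg ?P)" for f
  proof -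
    have "?d m = ?d n \<longleftrightarrow> ?g m = ?g n" if "m \<in> Poly_Mapping.keys f" "n \<in> Poly_Mapping.keys f" for m n
      using same_degree_iff[of m n] that \<open>f \<in> carrier (poly_alg ?P)\<close> by simp
    then show ?thesis
      using pushforward_eq_0_transfer[of ?d f ?g] pushforward_eq_0_transfer[of ?g f ?d] by blast
  qed
  ultimately show ?thesis by blast
qed

end

theorem theorem3p6:
  fixes T T' S :: "'a rtree" and h l :: 'a and m :: nat
  assumes "rooted_tree T'"
    and "l \<in> Lv T'" and "l \<noteq> tree_root T'"
    and "(h, l) \<in> parcs (tree_graph T')"
    and "star_tree m h l S"
    and "pverts (tree_graph T') \<inter> pverts (tree_graph S) = {h, l}"
    and "T = glue T' S"
  shows "tree_ideal T =
    toric_fiber_product T' S h l (tree_ideal_star T') (tree_ideal_star S)"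
proof -
  interpret glued_star T T' S h l m using assms by unfold_locales
  show ?thesis by (rule tree_ideal_eq_toric_fiber_product)
qed

end
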